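(* Let $\mathcal{A}$ be a category of algebras, $\mathcal{K}$ a Boolean factor congruences presheaf over $\mathcal{A}$, and $A\in\mathcal{A}$. Then the following conditions are equivalent: 1. $A$ has the $CBS_{\mathcal{K}}$-property. 2. For each isomorphism $f:A\to A/\theta$, where $\theta\in\mathcal{K}(A)$, and for each $\sigma\in\mathcal{K}(A)$ with $\sigma\subseteq\theta$, there exist $\zeta\in\langle\sigma\rangle_\theta$ and a CBS-sequence $(\sigma_{2n}\lor\neg\sigma_{2n+1})_{n\ge 0}$ for $f,\theta,\zeta$ such that the infimum in $(\mathcal{K}(A),\subseteq)$ of the family $(\sigma_{2n}\lor\neg\sigma_{2n+1})_{n\ge 1}$ exists.
   Context: A category of algebras $\mathcal{A}$ has as objects algebras of one fixed type $\tau$ and as morphisms all $\tau$-homomorphisms between its objects; $\cong$ means $\tau$-isomorphic. $Con(A)$ is the congruence lattice of $A$, with least element $\Delta_A$ and greatest element $\nabla_A=A^2$; $\lor$ denotes join in $Con(A)$; intervals are taken in $Con(A)$. For $\sigma\subseteq\theta$ in $Con(A)$ put $\theta/\sigma=\{(x_\sigma,y_\sigma)\in (A/\sigma)^2:(x,y)\in\theta\}\in Con(A/\sigma)$. For a homomorphism $f:A\to B$ and $\theta\in Con(B)$ put $f^*(\theta)=\{(a,b)\in A^2:(f(a),f(b))\in\theta\}$. A congruences operator over $\mathcal{A}$ is an assignment $A\mapsto\mathcal{K}(A)\subseteq Con(A)$ such that (i) $\Delta_A\in\mathcal{K}(A)$; (ii) $A/\sigma\in\mathcal{A}$ for $\sigma\in\mathcal{K}(A)$;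 (iii) for each isomorphism $f:A\to B$ in $\mathcal{A}$, $f^*$ restricts to an order isomorphism $\mathcal{K}(B)\to\mathcal{K}(A)$. It is a congruences presheaf if for all $A\in\mathcal{A}$, $\sigma\in\mathcal{K}(A)$, $\theta\in[\sigma,\nabla_A]$: $\theta\in\mathcal{K}(A)$ iff $\theta/\sigma\in\mathcal{K}(A/\sigma)$. A pair $(\theta,\neg\theta)$ of congruences on $A$ is a pair of factor congruences if $\theta\cap\neg\theta=\Delta_A$ and $\theta\circ\neg\theta=\nabla_A$ (relational product); $\neg\theta$ is then called a factor complement of $\theta$; it is a pair of factor congruences in $\mathcal{K}(A)$ if both members are in $\mathcal{K}(A)$. $FC(A)$ is the set of congruences belonging to some such pair. A Boolean factor congruences presheaf is a congruences presheaf $\mathcal{K}$ such that for each $A\in\mathcal{A}$: (1) $\mathcal{K}(A)\subseteq FC(A)$; (2) $\langle\mathcal{K}(A),\cap,\lor,\neg,\Delta_A,\nabla_A\rangle$ is a Boolean sublattice of $Con(A)$, where $\neg$ is the factor complement. $A\in\mathcal{A}$ has the $CBS_{\mathcal{K}}$-property iff: for every $B\in\mathcal{A}$, $\theta_B\in\mathcal{K}(B)$ and $\theta_A\in\mathcal{K}(A)$ with $A\cong B/\theta_B$ and $B\cong A/\theta_A$, one has $A\cong B$. CBS-sequences. Let $\theta\in\mathcal{K}(A)$ and let $f:A\to A/\theta$ be an isomorphism. For $\rho\in Con(A)$ let $f_*(\rho)=\{(f(a),f(b)):(a,b)\in\rho\}\in Con(A/\theta)$, and let $\hat f(\rho)$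 be the unique congruence in $[\theta,\nabla_A]$ with $\hat f(\rho)/\theta=f_*(\rho)$. Then $\hat f$ restricts to an order isomorphism $\mathcal{K}(A)\to\mathcal{K}(A)\cap[\theta,\nabla_A]$. For $\sigma\in\mathcal{K}(A)$ with $\sigma\subseteq\theta$ put $\langle\sigma\rangle_\theta=\{\zeta\in\mathcal{K}(A):\zeta\subseteq\theta,\ A/\sigma\cong A/\zeta\}$. Given $\zeta\in\langle\sigma\rangle_\theta$, define $\sigma_0=\Delta_A$, $\sigma_1=\zeta$, $\sigma_{n+2}=\hat f(\sigma_n)$ for $n\ge 0$ (so $\sigma_2=\theta$). A CBS-sequence (for $f,\theta,\zeta$) is a sequence $(\sigma_{2n}\lor\neg\sigma_{2n+1})_{n\ge 0}$ where, for some $\neg\hat f(\zeta)\in\mathcal{K}(A)$ such that $(\hat f(\zeta),\neg\hat f(\zeta))$ is a pair of factor congruences in $\mathcal{K}(A)$, one sets $\neg\sigma_1=\neg\zeta=\hat f^{-1}(\theta\lor\neg\hat f(\zeta))$ and $\neg\sigma_{2n+3}=\hat f(\neg\sigma_{2n+1})$ for $n\ge 0$. *)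

theory Defs
  imports Main "HOL-Library.Lub_Glb"
begin

section \<open>Algebras, homomorphisms, congruences\<close>

record 'f alg_type =
  symbols :: "'f set"
  arity :: "'f \<Rightarrow> nat"

record ('f, 'u) alg =
  carrier :: "'u set"
  oper :: "'f \<Rightarrow> 'u list \<Rightarrow> 'u"

definition args :: "'f alg_type \<Rightarrow> ('f, 'u) alg \<Rightarrow> 'f \<Rightarrow> 'u list set" where
  "args \<tau> A s = {xs. length xs = arity \<tau> s \<and> set xs \<subseteq> carrier A}"

text \<open>The last clause fixes the junk values of the total function \<open>oper A\<close>, so that
  two algebras of type \<open>\<tau>\<close> are equal as records iff they are equal as algebras. The
  carrier may be empty.\<close>

definition algebra :: "'f alg_type \<Rightarrow> ('f, 'u) alg \<Rightarrow> bool" where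
  "algebra \<tau> A \<longleftrightarrow>
     (\<forall>s\<in>symbols \<tau>. \<forall>xs\<in>args \<tau> A s. oper A s xs \<in> carrier A) \<and>
     (\<forall>s xs. \<not> (s \<in> symbols \<tau> \<and> xs \<in> args \<tau> A s) \<longrightarrow> oper A s xs = undefined)"

definition is_hom ::
  "'f alg_type \<Rightarrow> ('f, 'u) alg \<Rightarrow> ('f, 'v) alg \<Rightarrow> ('u \<Rightarrow> 'v) \<Rightarrow> bool" where
  "is_hom \<tau> A B f \<longleftrightarrow> f ` carrier A \<subseteq> carrier B \<and>
     (\<forall>s\<in>symbols \<tau>. \<forall>xs\<in>args \<tau> A s. f (oper A s xs) = oper B s (map f xs))"

definition is_iso ::
  "'f alg_type \<Rightarrow> ('f, 'u) alg \<Rightarrow> ('f, 'v) alg \<Rightarrow> ('u \<Rightarrow> 'v) \<Rightarrow> bool" where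
  "is_iso \<tau> A B f \<longleftrightarrow> is_hom \<tau> A B f \<and> bij_betw f (carrier A) (carrier B)"

definition isomorphic :: "'f alg_type \<Rightarrow> ('f, 'u) alg \<Rightarrow> ('f, 'v) alg \<Rightarrow> bool" where
  "isomorphic \<tau> A B \<longleftrightarrow> (\<exists>f. is_iso \<tau> A B f)"

definition Con :: "'f alg_type \<Rightarrow> ('f, 'u) alg \<Rightarrow> ('u \<times> 'u) set set" where
  "Con \<tau> A = {\<theta>. equiv (carrier A) \<theta> \<and>
     (\<forall>s\<in>symbols \<tau>. \<forall>xs\<in>args \<tau> A s. \<forall>ys\<in>args \<tau> A s.
        list_all2 (\<lambda>x y. (x, y) \<in> \<theta>) xs ys \<longrightarrow> (oper A s xs, oper A s ys) \<in> \<theta>)}"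

definition Delta :: "('f, 'u) alg \<Rightarrow> ('u \<times> 'u) set" where
  "Delta A = Id_on (carrier A)"

definition Nabla :: "('f, 'u) alg \<Rightarrow> ('u \<times> 'u) set" where
  "Nabla A = carrier A \<times> carrier A"

definition con_join ::
  "'f alg_type \<Rightarrow> ('f, 'u) alg \<Rightarrow> ('u \<times> 'u) set \<Rightarrow> ('u \<times> 'u) set \<Rightarrow> ('u \<times> 'u) set" where
  "con_join \<tau> A \<theta> \<sigma> = \<Inter>{\<rho> \<in> Con \<tau> A. \<theta> \<subseteq> \<rho> \<and> \<sigma> \<subseteq> \<rho>}"

definition con_interval ::
  "'f alg_type \<Rightarrow> ('f, 'u) alg \<Rightarrow> ('u \<times> 'u) set \<Rightarrow> ('u \<times> 'u) set \<Rightarrow> ('u \<times> 'u) set set" where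
  "con_interval \<tau> A \<sigma> \<rho> = {\<theta> \<in> Con \<tau> A. \<sigma> \<subseteq> \<theta> \<and> \<theta> \<subseteq> \<rho>}"

definition pull :: "('f, 'u) alg \<Rightarrow> ('u \<Rightarrow> 'v) \<Rightarrow> ('v \<times> 'v) set \<Rightarrow> ('u \<times> 'u) set" where
  "pull A f \<theta> = {(a, b). a \<in> carrier A \<and> b \<in> carrier A \<and> (f a, f b) \<in> \<theta>}"

definition push :: "('u \<Rightarrow> 'v) \<Rightarrow> ('u \<times> 'u) set \<Rightarrow> ('v \<times> 'v) set" where
  "push f \<rho> = {(f a, f b) | a b. (a, b) \<in> \<rho>}"

section \<open>Quotients\<close>

text \<open>All algebras of a category live on one type \<open>'u\<close>, the universe. The classes of
  a congruence have type \<open>'u set\<close>, so a quotient is an algebra over \<open>'u\<close> only after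
  its classes are named by elements of \<open>'u\<close>. The map \<open>e :: 'u set \<Rightarrow> 'u\<close> does that; it
  is a parameter throughout, subject only to naming distinct classes of one congruence
  differently (\<open>class_naming\<close>). If \<open>'u\<close> models a set-theoretic universe, \<open>e\<close> can be the
  map that regards a class as an element of the universe, and then \<open>A/\<sigma>\<close> is literally
  the algebra of classes. On any type, choosing a representative of each class is
  possible (\<open>class_naming_representatives\<close>), so the condition on \<open>e\<close> does not
  restrict the algebras.\<close>

definition cls :: "('u set \<Rightarrow> 'u) \<Rightarrow> ('u \<times> 'u) set \<Rightarrow> 'u \<Rightarrow> 'u" where
  "cls e \<sigma> x = e (\<sigma> `` {x})"

definition quot ::
  "'f alg_type \<Rightarrow> ('u set \<Rightarrow> 'u) \<Rightarrow> ('f, 'u) alg \<Rightarrow> ('u \<times> 'u) set \<Rightarrow> ('f, 'u) alg" where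
  "quot \<tau> e A \<sigma> = \<lparr>
     carrier = e ` (carrier A // \<sigma>),
     oper = (\<lambda>s ys.
       if s \<in> symbols \<tau> \<and> length ys = arity \<tau> s \<and> set ys \<subseteq> e ` (carrier A // \<sigma>)
       then THE z. \<exists>xs\<in>args \<tau> A s. ys = map (cls e \<sigma>) xs \<and> z = cls e \<sigma> (oper A s xs)
       else undefined)\<rparr>"

definition con_quot ::
  "('u set \<Rightarrow> 'u) \<Rightarrow> ('u \<times> 'u) set \<Rightarrow> ('u \<times> 'u) set \<Rightarrow> ('u \<times> 'u) set" where
  "con_quot e \<theta> \<sigma> = {(cls e \<sigma> x, cls e \<sigma> y) | x y. (x, y) \<in> \<theta>}"

definition category_of_algebras :: "'f alg_type \<Rightarrow> ('f, 'u) alg set \<Rightarrow> bool" where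
  "category_of_algebras \<tau> \<A> \<longleftrightarrow> (\<forall>A\<in>\<A>. algebra \<tau> A)"

definition class_naming ::
  "'f alg_type \<Rightarrow> ('f, 'u) alg set \<Rightarrow> ('u set \<Rightarrow> 'u) \<Rightarrow> bool" where
  "class_naming \<tau> \<A> e \<longleftrightarrow> (\<forall>A\<in>\<A>. \<forall>\<sigma>\<in>Con \<tau> A. inj_on e (carrier A // \<sigma>))"

lemma class_naming_representatives: "class_naming \<tau> \<A> (\<lambda>X. SOME x. x \<in> X)"
  unfolding class_naming_def
proof (intro ballI inj_onI)
  fix A \<sigma> X Y
  assume "\<sigma> \<in> Con \<tau> A" and X: "X \<in> carrier A // \<sigma>" and Y: "Y \<in> carrier A // \<sigma>"
    and eq: "(SOME x. x \<in> X) = (SOME x. x \<in> Y)"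
  then have eqv: "equiv (carrier A) \<sigma>" by (simp add: Con_def)
  have "(SOME x. x \<in> X) \<in> X" "(SOME x. x \<in> Y) \<in> Y"
    using in_quotient_imp_non_empty[OF eqv X] in_quotient_imp_non_empty[OF eqv Y]
    by (simp_all add: some_in_eq)
  with eq show "X = Y"
    using quotient_disj[OF eqv X Y] by auto
qed

section \<open>Congruences operators and presheaves\<close>

definition congruences_operator ::
  "'f alg_type \<Rightarrow> ('u set \<Rightarrow> 'u) \<Rightarrow> ('f, 'u) alg set
   \<Rightarrow> (('f, 'u) alg \<Rightarrow> ('u \<times> 'u) set set) \<Rightarrow> bool" where
  "congruences_operator \<tau> e \<A> \<K> \<longleftrightarrow>
     (\<forall>A\<in>\<A>. \<K> A \<subseteq> Con \<tau> A) \<and>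
     (\<forall>A\<in>\<A>. Delta A \<in> \<K> A) \<and>
     (\<forall>A\<in>\<A>. \<forall>\<sigma>\<in>\<K> A. quot \<tau> e A \<sigma> \<in> \<A>) \<and>
     (\<forall>A\<in>\<A>. \<forall>B\<in>\<A>. \<forall>f. is_iso \<tau> A B f \<longrightarrow>
        bij_betw (pull A f) (\<K> B) (\<K> A) \<and>
        (\<forall>\<theta>\<in>\<K> B. \<forall>\<theta>'\<in>\<K> B. \<theta> \<subseteq> \<theta>' \<longleftrightarrow> pull A f \<theta> \<subseteq> pull A f \<theta>'))"

definition congruences_presheaf ::
  "'f alg_type \<Rightarrow> ('u set \<Rightarrow> 'u) \<Rightarrow> ('f, 'u) alg set
   \<Rightarrow> (('f, 'u) alg \<Rightarrow> ('u \<times> 'u) set set) \<Rightarrow> bool" where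
  "congruences_presheaf \<tau> e \<A> \<K> \<longleftrightarrow> congruences_operator \<tau> e \<A> \<K> \<and>
     (\<forall>A\<in>\<A>. \<forall>\<sigma>\<in>\<K> A. \<forall>\<theta>\<in>con_interval \<tau> A \<sigma> (Nabla A).
        \<theta> \<in> \<K> A \<longleftrightarrow> con_quot e \<theta> \<sigma> \<in> \<K> (quot \<tau> e A \<sigma>))"

definition factor_pair ::
  "'f alg_type \<Rightarrow> ('f, 'u) alg \<Rightarrow> ('u \<times> 'u) set \<Rightarrow> ('u \<times> 'u) set \<Rightarrow> bool" where
  "factor_pair \<tau> A \<theta> \<nu> \<longleftrightarrow> \<theta> \<in> Con \<tau> A \<and> \<nu> \<in> Con \<tau> A \<and>
     \<theta> \<inter> \<nu> = Delta A \<and> \<theta> O \<nu> = Nabla A"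

definition FC :: "'f alg_type \<Rightarrow> ('f, 'u) alg \<Rightarrow> ('u \<times> 'u) set set" where
  "FC \<tau> A = {\<theta>. \<exists>\<nu>. factor_pair \<tau> A \<theta> \<nu> \<or> factor_pair \<tau> A \<nu> \<theta>}"

definition boolean_sublattice ::
  "'f alg_type \<Rightarrow> ('f, 'u) alg \<Rightarrow> ('u \<times> 'u) set set
   \<Rightarrow> (('u \<times> 'u) set \<Rightarrow> ('u \<times> 'u) set) \<Rightarrow> bool" where
  "boolean_sublattice \<tau> A L neg \<longleftrightarrow>
     L \<subseteq> Con \<tau> A \<and> Delta A \<in> L \<and> Nabla A \<in> L \<and>
     (\<forall>x\<in>L. \<forall>y\<in>L. x \<inter> y \<in> L \<and> con_join \<tau> A x y \<in> L) \<and>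
     (\<forall>x\<in>L. \<forall>y\<in>L. \<forall>z\<in>L. x \<inter> con_join \<tau> A y z = con_join \<tau> A (x \<inter> y) (x \<inter> z)) \<and>
     (\<forall>x\<in>L. neg x \<in> L \<and> x \<inter> neg x = Delta A \<and> con_join \<tau> A x (neg x) = Nabla A)"

text \<open>A factor complement that lies in \<open>\<K> A\<close> is in particular a complement in the
  distributive lattice \<open>\<K> A\<close>, so the operation \<open>neg\<close> below is unique on \<open>\<K> A\<close>.\<close>

definition boolean_factor_congruences_presheaf ::
  "'f alg_type \<Rightarrow> ('u set \<Rightarrow> 'u) \<Rightarrow> ('f, 'u) alg set
   \<Rightarrow> (('f, 'u) alg \<Rightarrow> ('u \<times> 'u) set set) \<Rightarrow> bool" where
  "boolean_factor_congruences_presheaf \<tau> e \<A> \<K> \<longleftrightarrow> congruences_presheaf \<tau> e \<A> \<K> \<and>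
     (\<forall>A\<in>\<A>. \<K> A \<subseteq> FC \<tau> A \<and>
        (\<exists>neg. (\<forall>\<theta>\<in>\<K> A. factor_pair \<tau> A \<theta> (neg \<theta>)) \<and>
               boolean_sublattice \<tau> A (\<K> A) neg))"

section \<open>The CBS-property and CBS-sequences\<close>

definition CBS_property ::
  "'f alg_type \<Rightarrow> ('u set \<Rightarrow> 'u) \<Rightarrow> ('f, 'u) alg set
   \<Rightarrow> (('f, 'u) alg \<Rightarrow> ('u \<times> 'u) set set) \<Rightarrow> ('f, 'u) alg \<Rightarrow> bool" where
  "CBS_property \<tau> e \<A> \<K> A \<longleftrightarrow>
     (\<forall>B\<in>\<A>. \<forall>\<theta>B\<in>\<K> B. \<forall>\<theta>A\<in>\<K> A.
        isomorphic \<tau> A (quot \<tau> e B \<theta>B) \<and> isomorphic \<tau> B (quot \<tau> e A \<theta>A) \<longrightarrow>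
        isomorphic \<tau> A B)"

definition fhat ::
  "'f alg_type \<Rightarrow> ('u set \<Rightarrow> 'u) \<Rightarrow> ('f, 'u) alg \<Rightarrow> ('u \<Rightarrow> 'u) \<Rightarrow> ('u \<times> 'u) set
   \<Rightarrow> ('u \<times> 'u) set \<Rightarrow> ('u \<times> 'u) set" where
  "fhat \<tau> e A f \<theta> \<rho> =
     (THE \<nu>. \<nu> \<in> con_interval \<tau> A \<theta> (Nabla A) \<and> con_quot e \<nu> \<theta> = push f \<rho>)"

definition angle ::
  "'f alg_type \<Rightarrow> ('u set \<Rightarrow> 'u) \<Rightarrow> (('f, 'u) alg \<Rightarrow> ('u \<times> 'u) set set) \<Rightarrow> ('f, 'u) alg
   \<Rightarrow> ('u \<times> 'u) set \<Rightarrow> ('u \<times> 'u) set \<Rightarrow> ('u \<times> 'u) set set" where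
  "angle \<tau> e \<K> A \<theta> \<sigma> =
     {\<zeta> \<in> \<K> A. \<zeta> \<subseteq> \<theta> \<and> isomorphic \<tau> (quot \<tau> e A \<sigma>) (quot \<tau> e A \<zeta>)}"

fun cbs_sigma ::
  "'f alg_type \<Rightarrow> ('u set \<Rightarrow> 'u) \<Rightarrow> ('f, 'u) alg \<Rightarrow> ('u \<Rightarrow> 'u) \<Rightarrow> ('u \<times> 'u) set
   \<Rightarrow> ('u \<times> 'u) set \<Rightarrow> nat \<Rightarrow> ('u \<times> 'u) set" where
  "cbs_sigma \<tau> e A f \<theta> \<zeta> 0 = Delta A"
| "cbs_sigma \<tau> e A f \<theta> \<zeta> (Suc 0) = \<zeta>"
| "cbs_sigma \<tau> e A f \<theta> \<zeta> (Suc (Suc n)) = fhat \<tau> e A f \<theta> (cbs_sigma \<tau> e A f \<theta> \<zeta> n)"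

text \<open>\<open>cbs_neg \<tau> e \<K> A f \<theta> \<nu> n\<close> is \<open>\<not>\<sigma>\<^bsub>2n+1\<^esub>\<close>, where \<open>\<nu>\<close> is the chosen factor complement
  of \<open>fhat \<tau> e A f \<theta> \<zeta>\<close>; the inverse in the first equation is that of the restriction
  of \<open>fhat\<close> to \<open>\<K> A\<close>.\<close>

fun cbs_neg ::
  "'f alg_type \<Rightarrow> ('u set \<Rightarrow> 'u) \<Rightarrow> (('f, 'u) alg \<Rightarrow> ('u \<times> 'u) set set) \<Rightarrow> ('f, 'u) alg
   \<Rightarrow> ('u \<Rightarrow> 'u) \<Rightarrow> ('u \<times> 'u) set \<Rightarrow> ('u \<times> 'u) set \<Rightarrow> nat \<Rightarrow> ('u \<times> 'u) set" where
  "cbs_neg \<tau> e \<K> A f \<theta> \<nu> 0 = inv_into (\<K> A) (fhat \<tau> e A f \<theta>) (con_join \<tau> A \<theta> \<nu>)"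
| "cbs_neg \<tau> e \<K> A f \<theta> \<nu> (Suc n) = fhat \<tau> e A f \<theta> (cbs_neg \<tau> e \<K> A f \<theta> \<nu> n)"

definition CBS_sequence ::
  "'f alg_type \<Rightarrow> ('u set \<Rightarrow> 'u) \<Rightarrow> (('f, 'u) alg \<Rightarrow> ('u \<times> 'u) set set) \<Rightarrow> ('f, 'u) alg
   \<Rightarrow> ('u \<Rightarrow> 'u) \<Rightarrow> ('u \<times> 'u) set \<Rightarrow> ('u \<times> 'u) set \<Rightarrow> (nat \<Rightarrow> ('u \<times> 'u) set) \<Rightarrow> bool" where
  "CBS_sequence \<tau> e \<K> A f \<theta> \<zeta> s \<longleftrightarrow>
     (\<exists>\<nu>. fhat \<tau> e A f \<theta> \<zeta> \<in> \<K> A \<and> \<nu> \<in> \<K> A \<and> factor_pair \<tau> A (fhat \<tau> e A f \<theta> \<zeta>) \<nu> \<and>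
        (\<forall>n. s n = con_join \<tau> A (cbs_sigma \<tau> e A f \<theta> \<zeta> (2 * n)) (cbs_neg \<tau> e \<K> A f \<theta> \<nu> n)))"

end

theory Submission
  imports Defs
begin

text \<open>
  A factor congruence \<open>\<theta>\<close> in \<open>\<K> A\<close> stands for a direct factor \<open>A/\<theta>\<close> of \<open>A\<close>, and a larger
  congruence for a smaller factor. Under this reading the theorem is the
  Cantor--Bernstein--Schroeder argument in the Boolean algebra of factors.

  Suppose the infima exist, \<open>A \<cong> B/\<theta>\<^sub>B\<close> and \<open>B \<cong> A/\<sigma>\<close>. Composing the two isomorphisms gives
  \<open>f : A \<cong> A/\<theta>\<close> for some \<open>\<theta> \<in> \<K> A\<close> with \<open>\<sigma> \<subseteq> \<theta>\<close>, and the hypothesis provides \<open>\<zeta>\<close> with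
  \<open>A/\<zeta> \<cong> A/\<sigma> \<cong> B\<close> and a CBS-sequence \<open>s\<close> with an infimum \<open>\<iota>\<close> of \<open>s 1, s 2, \<dots>\<close>. It remains to show
  \<open>A \<cong> A/\<zeta>\<close>. The map \<open>\<phi>\<close> induced by \<open>f\<close> on congruences is an order isomorphism of \<open>\<K> A\<close> onto
  the part of \<open>\<K> A\<close> above \<open>\<theta>\<close>, it takes \<open>s n\<close> to \<open>s (n + 1)\<close>, and \<open>s 0\<close> is the complement of \<open>\<zeta>\<close>
  (\<open>CBS_sequence_shift\<close>). Hence \<open>\<phi>\<close> takes the infimum \<open>\<kappa> = \<iota> \<inter> s 0\<close> of the whole sequence to the
  infimum \<open>\<iota>\<close> of its tail (\<open>infimum_shift\<close>), and \<open>f\<close> induces \<open>A/\<kappa> \<cong> A/\<iota>\<close>. If \<open>c\<close> is the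
  complement of \<open>\<kappa>\<close>, then \<open>\<iota> \<inter> c = \<zeta>\<close> (\<open>meet_complement_eq\<close>). So \<open>A \<cong> A/\<kappa> \<times> A/c\<close> and
  \<open>A/\<zeta> \<cong> A/\<iota> \<times> A/c\<close>, and the isomorphism between the left factors together with the identity on
  the common right factor gives \<open>A \<cong> A/\<zeta>\<close> (\<open>correspondence_gluing\<close>).

  Conversely, let \<open>A\<close> have the CBS-property, \<open>A \<cong> A/\<theta>\<close> and \<open>\<sigma> \<subseteq> \<theta>\<close>. Since \<open>A/\<theta>\<close> is a quotient of
  \<open>A/\<sigma>\<close>, the property applies to \<open>B = A/\<sigma>\<close> and gives \<open>A \<cong> A/\<sigma>\<close>. Therefore \<open>\<zeta>\<close> may be taken to be
  the least congruence, and the CBS-sequence is then constantly the greatest one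
  (\<open>CBS_sequence_Delta\<close>).

  Isomorphisms between quotients are handled through relations between the original algebras.
  This treats composites, iterated quotients and the gluing of two partial isomorphisms
  uniformly, without names of classes and without direct products.
\<close>

section \<open>Isomorphisms of quotients as correspondences\<close>

text \<open>A quotient up to isomorphism: this covers the identity, the canonical maps onto quotients
  and their composites alike.\<close>

definition quotient_hom ::
  "'f alg_type \<Rightarrow> ('f, 'u) alg \<Rightarrow> ('f, 'v) alg \<Rightarrow> ('u \<Rightarrow> 'v) \<Rightarrow> ('u \<times> 'u) set \<Rightarrow> bool" where
  "quotient_hom \<tau> A P p \<rho> \<longleftrightarrow> is_hom \<tau> A P p \<and> p ` carrier A = carrier P \<and>
     (\<forall>x\<in>carrier A. \<forall>y\<in>carrier A. (x, y) \<in> \<rho> \<longleftrightarrow> p x = p y)"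

text \<open>The pairs \<open>(x, y)\<close> such that the class of \<open>x\<close> modulo \<open>\<rho>\<close> is sent to the class of \<open>y\<close> modulo \<open>\<zeta>\<close>
  by an isomorphism \<open>A/\<rho> \<cong> B/\<zeta>\<close> have these properties. A relation with these properties need not be
  saturated: it may relate fewer pairs than the isomorphism does, but still enough to
  determine it.\<close>

definition correspondence ::
  "'f alg_type \<Rightarrow> ('f, 'u) alg \<Rightarrow> ('u \<times> 'u) set \<Rightarrow> ('f, 'v) alg \<Rightarrow> ('v \<times> 'v) set
   \<Rightarrow> ('u \<times> 'v) set \<Rightarrow> bool" where
  "correspondence \<tau> A \<rho> B \<zeta> R \<longleftrightarrow>
     R \<subseteq> carrier A \<times> carrier B \<and>
     (\<forall>x\<in>carrier A. \<exists>y. (x, y) \<in> R) \<and> (\<forall>y\<in>carrier B. \<exists>x. (x, y) \<in> R) \<and>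
     (\<forall>s\<in>symbols \<tau>. \<forall>xs\<in>args \<tau> A s. \<forall>ys\<in>args \<tau> B s.
        list_all2 (\<lambda>x y. (x, y) \<in> R) xs ys \<longrightarrow> (oper A s xs, oper B s ys) \<in> R) \<and>
     (\<forall>x y x' y'. (x, y) \<in> R \<longrightarrow> (x', y') \<in> R \<longrightarrow> ((x, x') \<in> \<rho> \<longleftrightarrow> (y, y') \<in> \<zeta>))"

lemma correspondenceI:
  assumes "R \<subseteq> carrier A \<times> carrier B"
    and "\<And>x. x \<in> carrier A \<Longrightarrow> \<exists>y. (x, y) \<in> R"
    and "\<And>y. y \<in> carrier B \<Longrightarrow> \<exists>x. (x, y) \<in> R"
    and "\<And>s xs ys. s \<in> symbols \<tau> \<Longrightarrow> xs \<in> args \<tau> A s \<Longrightarrow> ys \<in> args \<tau> B s \<Longrightarrow>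
      list_all2 (\<lambda>x y. (x, y) \<in> R) xs ys \<Longrightarrow> (oper A s xs, oper B s ys) \<in> R"
    and "\<And>x y x' y'. (x, y) \<in> R \<Longrightarrow> (x', y') \<in> R \<Longrightarrow> (x, x') \<in> \<rho> \<longleftrightarrow> (y, y') \<in> \<zeta>"
  shows "correspondence \<tau> A \<rho> B \<zeta> R"
  unfolding correspondence_def using assms by (intro conjI ballI allI impI)

lemma correspondenceD:
  assumes "correspondence \<tau> A \<rho> B \<zeta> R"
  shows correspondence_carrier: "R \<subseteq> carrier A \<times> carrier B"
    and correspondence_total: "x \<in> carrier A \<Longrightarrow> \<exists>y. (x, y) \<in> R"
    and correspondence_onto: "y \<in> carrier B \<Longrightarrow> \<exists>x. (x, y) \<in> R"
    and correspondence_oper: "s \<in> symbols \<tau> \<Longrightarrow> xs \<in> args \<tau> A s \<Longrightarrow> ys \<in> args \<tau> B s \<Longrightarrow>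
      list_all2 (\<lambda>x y. (x, y) \<in> R) xs ys \<Longrightarrow> (oper A s xs, oper B s ys) \<in> R"
    and correspondence_match:
      "(x, y) \<in> R \<Longrightarrow> (x', y') \<in> R \<Longrightarrow> (x, x') \<in> \<rho> \<longleftrightarrow> (y, y') \<in> \<zeta>"
  using assms by (simp_all add: correspondence_def)

lemma args_map: "is_hom \<tau> A B f \<Longrightarrow> xs \<in> args \<tau> A s \<Longrightarrow> map f xs \<in> args \<tau> B s"
  by (auto simp: is_hom_def args_def image_subset_iff)

lemma oper_closed:
  "algebra \<tau> A \<Longrightarrow> s \<in> symbols \<tau> \<Longrightarrow> xs \<in> args \<tau> A s \<Longrightarrow> oper A s xs \<in> carrier A"
  by (simp add: algebra_def)

lemma is_hom_comp:
  assumes f: "is_hom \<tau> A B f" and g: "is_hom \<tau> B C g"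
  shows "is_hom \<tau> A C (g \<circ> f)"
  unfolding is_hom_def
proof (intro conjI ballI)
  show "(g \<circ> f) ` carrier A \<subseteq> carrier C"
    using f g by (auto simp: is_hom_def image_subset_iff)
next
  fix s xs assume "s \<in> symbols \<tau>" "xs \<in> args \<tau> A s"
  then show "(g \<circ> f) (oper A s xs) = oper C s (map (g \<circ> f) xs)"
    using f g args_map[OF f] by (simp add: is_hom_def)
qed

lemma quotient_hom_id: "quotient_hom \<tau> A A id (Delta A)"
  by (auto simp: quotient_hom_def is_hom_def Delta_def)

lemma quotient_hom_comp:
  assumes p: "quotient_hom \<tau> A P p \<rho>" and q: "quotient_hom \<tau> P Q q \<xi>"
  shows "quotient_hom \<tau> A Q (q \<circ> p) (pull A p \<xi>)"
proof -
  have im: "p ` carrier A = carrier P" "q ` carrier P = carrier Q"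
    using p q by (simp_all add: quotient_hom_def)
  then have "(q \<circ> p) ` carrier A = carrier Q" by (simp only: image_comp[symmetric])
  moreover have "is_hom \<tau> A Q (q \<circ> p)"
    using p q is_hom_comp[of \<tau> A P p Q q] by (simp add: quotient_hom_def)
  moreover have "(p x, p y) \<in> \<xi> \<longleftrightarrow> q (p x) = q (p y)" if "x \<in> carrier A" "y \<in> carrier A" for x y
  proof -
    have "p x \<in> carrier P" "p y \<in> carrier P" using im that by auto
    then show ?thesis using q by (simp add: quotient_hom_def)
  qed
  ultimately show ?thesis by (simp add: quotient_hom_def pull_def)
qed

lemma quotient_hom_comp_iso:
  assumes p: "quotient_hom \<tau> A P p \<rho>" and f: "is_iso \<tau> P Q f"
  shows "quotient_hom \<tau> A Q (f \<circ> p) \<rho>"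
proof -
  have im: "p ` carrier A = carrier P" "f ` carrier P = carrier Q" and inj: "inj_on f (carrier P)"
    using p f by (simp_all add: quotient_hom_def is_iso_def bij_betw_def)
  then have "f (p x) = f (p y) \<longleftrightarrow> p x = p y" if "x \<in> carrier A" "y \<in> carrier A" for x y
    using that by (intro inj_on_eq_iff[OF inj]) auto
  moreover have "(f \<circ> p) ` carrier A = carrier Q" using im by (simp only: image_comp[symmetric])
  ultimately show ?thesis
    using p f is_hom_comp[of \<tau> A P p Q f] by (simp add: quotient_hom_def is_iso_def)
qed

lemma correspondence_of_quotient_homs:
  assumes A: "algebra \<tau> A" and B: "algebra \<tau> B"
    and p: "quotient_hom \<tau> A P p \<rho>" and q: "quotient_hom \<tau> B P q \<zeta>"
  shows "correspondence \<tau> A \<rho> B \<zeta> {(x, y). x \<in> carrier A \<and> y \<in> carrier B \<and> p x = q y}"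
    (is "correspondence _ _ _ _ _ ?R")
proof (rule correspondenceI)
  show "?R \<subseteq> carrier A \<times> carrier B" by auto
next
  fix x assume "x \<in> carrier A"
  then have "p x \<in> q ` carrier B" using p q by (auto simp: quotient_hom_def)
  then show "\<exists>y. (x, y) \<in> ?R" using \<open>x \<in> carrier A\<close> by auto
next
  fix y assume "y \<in> carrier B"
  then have "q y \<in> p ` carrier A" using p q by (auto simp: quotient_hom_def)
  then show "\<exists>x. (x, y) \<in> ?R" using \<open>y \<in> carrier B\<close> by force
next
  fix s xs ys
  assume s: "s \<in> symbols \<tau>" and xs: "xs \<in> args \<tau> A s" and ys: "ys \<in> args \<tau> B s"
    and rel: "list_all2 (\<lambda>x y. (x, y) \<in> ?R) xs ys"
  from rel have "map p xs = map q ys"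
    by (induction rule: list_all2_induct) auto
  then have "p (oper A s xs) = q (oper B s ys)"
    using p q s xs ys by (simp add: quotient_hom_def is_hom_def)
  then show "(oper A s xs, oper B s ys) \<in> ?R"
    using oper_closed[OF A s xs] oper_closed[OF B s ys] by simp
next
  fix x y x' y' assume "(x, y) \<in> ?R" "(x', y') \<in> ?R"
  then show "(x, x') \<in> \<rho> \<longleftrightarrow> (y, y') \<in> \<zeta>"
    using p q by (simp add: quotient_hom_def)
qed

lemma args_preimage:
  assumes p: "p ` carrier A = carrier P" and us: "us \<in> args \<tau> P s"
  obtains xs where "xs \<in> args \<tau> A s" "us = map p xs"
proof -
  have "us \<in> lists (p ` carrier A)" using us p by (auto simp: args_def)
  then obtain xs where "xs \<in> lists (carrier A)" "us = map p xs"
    by (auto simp: lists_image)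
  with us show ?thesis by (intro that) (auto simp: args_def)
qed

text \<open>The map sends \<open>p x\<close> to \<open>q y\<close> for related \<open>x\<close> and \<open>y\<close>. Matching \<open>\<rho>\<close> with \<open>\<zeta>\<close> makes it
  well defined (left to right) and injective (right to left).\<close>

lemma isomorphic_of_correspondence:
  assumes p: "quotient_hom \<tau> A P p \<rho>" and q: "quotient_hom \<tau> B Q q \<zeta>"
    and R: "correspondence \<tau> A \<rho> B \<zeta> R"
  shows "isomorphic \<tau> P Q"
proof -
  define f where "f u = q (SOME y. \<exists>x. p x = u \<and> (x, y) \<in> R)" for u
  have sub: "R \<subseteq> carrier A \<times> carrier B"
    and match: "\<And>x y x' y'. (x, y) \<in> R \<Longrightarrow> (x', y') \<in> R \<Longrightarrow> (x, x') \<in> \<rho> \<longleftrightarrow> (y, y') \<in> \<zeta>"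
    and total: "\<And>x. x \<in> carrier A \<Longrightarrow> \<exists>y. (x, y) \<in> R"
    and onto: "\<And>y. y \<in> carrier B \<Longrightarrow> \<exists>x. (x, y) \<in> R"
    and compat: "\<And>s xs ys. s \<in> symbols \<tau> \<Longrightarrow> xs \<in> args \<tau> A s \<Longrightarrow> ys \<in> args \<tau> B s \<Longrightarrow>
      list_all2 (\<lambda>x y. (x, y) \<in> R) xs ys \<Longrightarrow> (oper A s xs, oper B s ys) \<in> R"
    by (rule correspondenceD[OF R]; assumption?)+
  have match': "p x = p x' \<longleftrightarrow> q y = q y'" if "(x, y) \<in> R" "(x', y') \<in> R" for x y x' y'
  proof -
    have "x \<in> carrier A" "x' \<in> carrier A" "y \<in> carrier B" "y' \<in> carrier B"
      using that sub by auto
    then show ?thesis using match[OF that] p q by (simp add: quotient_hom_def)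
  qed
  have f: "f (p x) = q y" if xy: "(x, y) \<in> R" for x y
  proof -
    define w where "w = (SOME y. \<exists>x'. p x' = p x \<and> (x', y) \<in> R)"
    have "\<exists>x'. p x' = p x \<and> (x', w) \<in> R"
      unfolding w_def
      by (rule someI[of "\<lambda>y. \<exists>x'. p x' = p x \<and> (x', y) \<in> R"]) (use xy in blast)
    then obtain x' where "p x' = p x" "(x', w) \<in> R" by blast
    then have "q w = q y" using match' xy by simp
    then show ?thesis by (simp add: f_def w_def)
  qed
  have P: "carrier P = p ` carrier A" and Q: "carrier Q = q ` carrier B"
    using p q by (auto simp: quotient_hom_def)
  have "is_hom \<tau> P Q f"
    unfolding is_hom_def
  proof (intro conjI ballI)
    show "f ` carrier P \<subseteq> carrier Q"
    proof
      fix v assume "v \<in> f ` carrier P"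
      then obtain x where x: "x \<in> carrier A" "v = f (p x)" using P by auto
      with total obtain y where "(x, y) \<in> R" by blast
      with x sub show "v \<in> carrier Q" by (auto simp: f Q)
    qed
  next
    fix s us assume s: "s \<in> symbols \<tau>" and us: "us \<in> args \<tau> P s"
    obtain xs where xs: "xs \<in> args \<tau> A s" "us = map p xs"
      using args_preimage[OF P[symmetric] us] by blast
    define ys where "ys = map (\<lambda>x. SOME y. (x, y) \<in> R) xs"
    have pick: "(x, SOME y. (x, y) \<in> R) \<in> R" if "x \<in> set xs" for x
    proof (rule someI_ex)
      have "x \<in> carrier A" using that xs(1) by (auto simp: args_def)
      then show "\<exists>y. (x, y) \<in> R" by (rule total)
    qed
    have rel: "list_all2 (\<lambda>x y. (x, y) \<in> R) xs ys"
      unfolding ys_def by (simp add: list_all2_map2 list_all2_same pick)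
    have ys: "ys \<in> args \<tau> B s"
      using xs sub pick by (auto simp: ys_def args_def)
    have "map f us = map q ys"
      using pick by (simp add: ys_def xs f)
    moreover have "f (p (oper A s xs)) = q (oper B s ys)"
      by (rule f) (rule compat[OF s xs(1) ys rel])
    moreover have "p (oper A s xs) = oper P s us" "q (oper B s ys) = oper Q s (map q ys)"
      using p q s xs ys by (auto simp: quotient_hom_def is_hom_def)
    ultimately show "f (oper P s us) = oper Q s (map f us)" by simp
  qed
  moreover have "bij_betw f (carrier P) (carrier Q)"
    unfolding bij_betw_def
  proof
    show "inj_on f (carrier P)"
    proof (rule inj_onI)
      fix u u' assume "u \<in> carrier P" "u' \<in> carrier P" and eq: "f u = f u'"
      then obtain x x' where x: "x \<in> carrier A" "u = p x" "x' \<in> carrier A" "u' = p x'"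
        using P by auto
      then obtain y y' where "(x, y) \<in> R" "(x', y') \<in> R" using total by meson
      with eq x match' show "u = u'" by (simp add: f)
    qed
    show "f ` carrier P = carrier Q"
    proof
      show "f ` carrier P \<subseteq> carrier Q" using \<open>is_hom \<tau> P Q f\<close> by (simp add: is_hom_def)
      show "carrier Q \<subseteq> f ` carrier P"
      proof
        fix v assume "v \<in> carrier Q"
        then obtain y where y: "y \<in> carrier B" "v = q y" using Q by auto
        with onto obtain x where "(x, y) \<in> R" by blast
        with y sub have "v = f (p x)" "p x \<in> carrier P" by (auto simp: f P)
        then show "v \<in> f ` carrier P" by blast
      qed
    qed
  qed
  ultimately show ?thesis by (auto simp: isomorphic_def is_iso_def)
qed

lemma correspondence_converse:
  assumes "correspondence \<tau> A \<rho> B \<zeta> R"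
  shows "correspondence \<tau> B \<zeta> A \<rho> (R\<inverse>)"
proof -
  have flip: "list_all2 (\<lambda>y x. (y, x) \<in> R\<inverse>) ys xs \<longleftrightarrow> list_all2 (\<lambda>x y. (x, y) \<in> R) xs ys"
    for xs ys
    using list.rel_flip[of "\<lambda>x y. (x, y) \<in> R" ys xs] by (simp add: conversep_iff[abs_def])
  show ?thesis
  proof (rule correspondenceI)
    show "R\<inverse> \<subseteq> carrier B \<times> carrier A"
      using correspondence_carrier[OF assms] by blast
    show "\<exists>x. (y, x) \<in> R\<inverse>" if "y \<in> carrier B" for y
      using correspondence_onto[OF assms that] by simp
    show "\<exists>y. (y, x) \<in> R\<inverse>" if "x \<in> carrier A" for x
      using correspondence_total[OF assms that] by simp
    show "(oper B s ys, oper A s xs) \<in> R\<inverse>"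
      if "s \<in> symbols \<tau>" "ys \<in> args \<tau> B s" "xs \<in> args \<tau> A s"
        "list_all2 (\<lambda>y x. (y, x) \<in> R\<inverse>) ys xs" for s ys xs
      using correspondence_oper[OF assms that(1,3,2)] that(4) unfolding flip by simp
    show "(y, y') \<in> \<zeta> \<longleftrightarrow> (x, x') \<in> \<rho>" if "(y, x) \<in> R\<inverse>" "(y', x') \<in> R\<inverse>" for y x y' x'
      using correspondence_match[OF assms] that by simp
  qed
qed

lemma correspondence_comp:
  assumes R: "correspondence \<tau> A \<rho> B \<zeta> R" and S: "correspondence \<tau> B \<zeta> C \<xi> S"
  shows "correspondence \<tau> A \<rho> C \<xi> (R O S)"
proof (rule correspondenceI)
  show "R O S \<subseteq> carrier A \<times> carrier C"
    using correspondence_carrier[OF R] correspondence_carrier[OF S] by blast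
  show "\<exists>z. (x, z) \<in> R O S" if "x \<in> carrier A" for x
  proof -
    obtain y where y: "(x, y) \<in> R" using correspondence_total[OF R \<open>x \<in> carrier A\<close>] by blast
    then have "y \<in> carrier B" using correspondence_carrier[OF R] by blast
    with y show ?thesis using correspondence_total[OF S] by blast
  qed
  show "\<exists>x. (x, z) \<in> R O S" if "z \<in> carrier C" for z
  proof -
    obtain y where y: "(y, z) \<in> S" using correspondence_onto[OF S \<open>z \<in> carrier C\<close>] by blast
    then have "y \<in> carrier B" using correspondence_carrier[OF S] by blast
    with y show ?thesis using correspondence_onto[OF R] by blast
  qed
next
  fix s xs zs
  assume s: "s \<in> symbols \<tau>" and xs: "xs \<in> args \<tau> A s" and zs: "zs \<in> args \<tau> C s"
    and rel: "list_all2 (\<lambda>x z. (x, z) \<in> R O S) xs zs"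
  from rel obtain ys where ys: "list_all2 (\<lambda>x y. (x, y) \<in> R) xs ys"
    "list_all2 (\<lambda>y z. (y, z) \<in> S) ys zs"
  proof (induction arbitrary: thesis rule: list_all2_induct)
    case Nil
    then show ?case by (metis list_all2_Nil)
  next
    case (Cons x xs z zs)
    then obtain ys where "list_all2 (\<lambda>x y. (x, y) \<in> R) xs ys"
      "list_all2 (\<lambda>y z. (y, z) \<in> S) ys zs" by blast
    moreover from Cons.hyps obtain y where "(x, y) \<in> R" "(y, z) \<in> S" by blast
    ultimately show ?case by (intro Cons.prems[of "y # ys"]) auto
  qed
  from ys(1) have "length ys = length xs" "set ys \<subseteq> carrier B"
    using correspondence_carrier[OF R] by (induction rule: list_all2_induct) auto
  with xs have "ys \<in> args \<tau> B s" by (auto simp: args_def)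
  then have "(oper A s xs, oper B s ys) \<in> R" "(oper B s ys, oper C s zs) \<in> S"
    using correspondence_oper[OF R s xs] correspondence_oper[OF S s _ zs] ys by blast+
  then show "(oper A s xs, oper C s zs) \<in> R O S" by blast
next
  fix x z x' z' assume "(x, z) \<in> R O S" "(x', z') \<in> R O S"
  then obtain y y' where "(x, y) \<in> R" "(y, z) \<in> S" "(x', y') \<in> R" "(y', z') \<in> S" by blast
  then show "(x, x') \<in> \<rho> \<longleftrightarrow> (z, z') \<in> \<xi>"
    using correspondence_match[OF R] correspondence_match[OF S] by simp
qed

lemma correspondence_of_iso:
  assumes "algebra \<tau> A" "algebra \<tau> B"
    and "quotient_hom \<tau> A P p \<rho>" "quotient_hom \<tau> B Q q \<zeta>" "is_iso \<tau> P Q f"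
  shows "correspondence \<tau> A \<rho> B \<zeta> {(x, y). x \<in> carrier A \<and> y \<in> carrier B \<and> f (p x) = q y}"
  using correspondence_of_quotient_homs[OF assms(1,2) quotient_hom_comp_iso[OF assms(3,5)] assms(4)]
  by simp

lemma isomorphic_sym:
  assumes A: "algebra \<tau> A" and B: "algebra \<tau> B" and iso: "isomorphic \<tau> A B"
  shows "isomorphic \<tau> B A"
proof -
  obtain f where "is_iso \<tau> A B f" using iso by (auto simp: isomorphic_def)
  from correspondence_converse[OF correspondence_of_iso[OF A B quotient_hom_id quotient_hom_id this]]
  show ?thesis by (rule isomorphic_of_correspondence[OF quotient_hom_id quotient_hom_id])
qed

lemma isomorphic_trans: "isomorphic \<tau> A B \<Longrightarrow> isomorphic \<tau> B C \<Longrightarrow> isomorphic \<tau> A C"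
  unfolding isomorphic_def is_iso_def by (blast intro: is_hom_comp bij_betw_trans)

lemma isomorphic_of_same_kernel:
  assumes A: "algebra \<tau> A" and p: "quotient_hom \<tau> A P p \<rho>" and q: "quotient_hom \<tau> A Q q \<rho>"
  shows "isomorphic \<tau> P Q"
  by (rule isomorphic_of_correspondence[OF p q correspondence_of_quotient_homs[OF A A p p]])

section \<open>Quotient algebras\<close>

lemma cls_eq_iff:
  assumes "inj_on e (carrier A // \<sigma>)" "\<sigma> \<in> Con \<tau> A" "x \<in> carrier A" "y \<in> carrier A"
  shows "cls e \<sigma> x = cls e \<sigma> y \<longleftrightarrow> (x, y) \<in> \<sigma>"
proof -
  have eq: "equiv (carrier A) \<sigma>" using assms by (simp add: Con_def)
  have "cls e \<sigma> x = cls e \<sigma> y \<longleftrightarrow> \<sigma> `` {x} = \<sigma> `` {y}"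
    unfolding cls_def using assms by (intro inj_on_eq_iff) (auto intro: quotientI)
  also have "\<dots> \<longleftrightarrow> (x, y) \<in> \<sigma>"
    using eq_equiv_class_iff[OF eq assms(3,4)] .
  finally show ?thesis .
qed

lemma cls_image_carrier: "cls e \<sigma> ` carrier A = carrier (quot \<tau> e A \<sigma>)"
  by (auto simp: cls_def quot_def quotient_def)

text \<open>The operations of \<open>quot\<close> are given by a definite description, so this lemma is where
  compatibility of \<open>\<sigma>\<close> with the operations is turned into well-definedness.\<close>

lemma quotient_hom_quot:
  assumes inj: "inj_on e (carrier A // \<sigma>)" and \<sigma>: "\<sigma> \<in> Con \<tau> A" and A: "algebra \<tau> A"
  shows "quotient_hom \<tau> A (quot \<tau> e A \<sigma>) (cls e \<sigma>) \<sigma>"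
proof -
  have "cls e \<sigma> (oper A s xs) = oper (quot \<tau> e A \<sigma>) s (map (cls e \<sigma>) xs)"
    if s: "s \<in> symbols \<tau>" and xs: "xs \<in> args \<tau> A s" for s xs
  proof -
    have "(THE z. \<exists>xs'\<in>args \<tau> A s. map (cls e \<sigma>) xs = map (cls e \<sigma>) xs' \<and>
        z = cls e \<sigma> (oper A s xs')) = cls e \<sigma> (oper A s xs)"
    proof (rule the_equality)
      fix z assume "\<exists>xs'\<in>args \<tau> A s. map (cls e \<sigma>) xs = map (cls e \<sigma>) xs' \<and>
        z = cls e \<sigma> (oper A s xs')"
      then obtain ys where ys: "ys \<in> args \<tau> A s" "map (cls e \<sigma>) xs = map (cls e \<sigma>) ys"
        "z = cls e \<sigma> (oper A s ys)" by blast
      have "list_all2 (\<lambda>x y. (x, y) \<in> \<sigma>) xs ys"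
      proof (rule list_all2_all_nthI)
        show len: "length xs = length ys" using ys(2) by (rule map_eq_imp_length_eq)
        fix i assume i: "i < length xs"
        then have "cls e \<sigma> (xs ! i) = cls e \<sigma> (ys ! i)"
          using arg_cong[OF ys(2), of "\<lambda>l. l ! i"] len by simp
        moreover have "xs ! i \<in> carrier A" "ys ! i \<in> carrier A"
          using xs ys(1) i len by (auto simp: args_def)
        ultimately show "(xs ! i, ys ! i) \<in> \<sigma>" using cls_eq_iff[OF inj \<sigma>] by blast
      qed
      then have "(oper A s xs, oper A s ys) \<in> \<sigma>"
        using \<sigma> s xs ys(1) by (auto simp: Con_def)
      then show "z = cls e \<sigma> (oper A s xs)"
        using ys(3) cls_eq_iff[OF inj \<sigma>] oper_closed[OF A s] xs ys(1) by metis
    qed (use xs in blast)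
    moreover have "set (map (cls e \<sigma>) xs) \<subseteq> e ` (carrier A // \<sigma>)"
      using xs by (auto simp: args_def cls_def quotient_def)
    ultimately show ?thesis using s xs by (simp add: quot_def args_def)
  qed
  then show ?thesis
    using cls_eq_iff[OF inj \<sigma>] cls_image_carrier[of e \<sigma> A \<tau>]
    by (auto simp: quotient_hom_def is_hom_def)
qed

lemma Con_subset: "\<rho> \<in> Con \<tau> A \<Longrightarrow> \<rho> \<subseteq> carrier A \<times> carrier A"
  by (auto simp: Con_def equiv_def refl_on_def)

lemma ConI:
  assumes "equiv (carrier A) \<rho>"
    and "\<And>s xs ys. s \<in> symbols \<tau> \<Longrightarrow> xs \<in> args \<tau> A s \<Longrightarrow> ys \<in> args \<tau> A s \<Longrightarrow>
      list_all2 (\<lambda>x y. (x, y) \<in> \<rho>) xs ys \<Longrightarrow> (oper A s xs, oper A s ys) \<in> \<rho>"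
  shows "\<rho> \<in> Con \<tau> A"
  using assms by (auto simp: Con_def)

lemma pull_in_Con:
  assumes A: "algebra \<tau> A" and f: "is_hom \<tau> A B f" and \<rho>: "\<rho> \<in> Con \<tau> B"
  shows "pull A f \<rho> \<in> Con \<tau> A"
proof (rule ConI)
  have mem: "f x \<in> carrier B" if "x \<in> carrier A" for x
    using f that by (auto simp: is_hom_def)
  have "equiv (carrier B) \<rho>" using \<rho> by (simp add: Con_def)
  then have r: "refl_on (carrier B) \<rho>" "sym \<rho>" "trans \<rho>" by (auto elim: equivE)
  show "equiv (carrier A) (pull A f \<rho>)"
  proof (rule equivI)
    show "pull A f \<rho> \<subseteq> carrier A \<times> carrier A" by (auto simp: pull_def)
    show "refl_on (carrier A) (pull A f \<rho>)"
      using r(1) mem by (auto simp: refl_on_def pull_def)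
    show "sym (pull A f \<rho>)" using r(2) by (auto simp: sym_def pull_def)
    show "trans (pull A f \<rho>)" using r(3) unfolding trans_def pull_def by blast
  qed
next
  fix s xs ys
  assume s: "s \<in> symbols \<tau>" and xs: "xs \<in> args \<tau> A s" and ys: "ys \<in> args \<tau> A s"
    and rel: "list_all2 (\<lambda>x y. (x, y) \<in> pull A f \<rho>) xs ys"
  have "list_all2 (\<lambda>x y. (x, y) \<in> \<rho>) (map f xs) (map f ys)"
    using rel by (auto simp: list_all2_conv_all_nth pull_def)
  then have "(oper B s (map f xs), oper B s (map f ys)) \<in> \<rho>"
    using \<rho> s args_map[OF f] xs ys by (auto simp: Con_def)
  then have "(f (oper A s xs), f (oper A s ys)) \<in> \<rho>"
    using f s xs ys by (simp add: is_hom_def)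
  then show "(oper A s xs, oper A s ys) \<in> pull A f \<rho>"
    using oper_closed[OF A s] xs ys by (simp add: pull_def)
qed

lemma Con_oper:
  "\<rho> \<in> Con \<tau> A \<Longrightarrow> s \<in> symbols \<tau> \<Longrightarrow> xs \<in> args \<tau> A s \<Longrightarrow> ys \<in> args \<tau> A s \<Longrightarrow>
   list_all2 (\<lambda>x y. (x, y) \<in> \<rho>) xs ys \<Longrightarrow> (oper A s xs, oper A s ys) \<in> \<rho>"
  by (simp add: Con_def)

lemma correspondence_Con:
  assumes \<rho>: "\<rho> \<in> Con \<tau> A"
  shows "correspondence \<tau> A \<rho> A \<rho> \<rho>"
proof (rule correspondenceI)
  have "equiv (carrier A) \<rho>" using \<rho> by (simp add: Con_def)
  then have r: "refl_on (carrier A) \<rho>" "sym \<rho>" "trans \<rho>" by (auto elim: equivE)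
  show "\<rho> \<subseteq> carrier A \<times> carrier A" using \<rho> by (rule Con_subset)
  show "\<exists>y. (x, y) \<in> \<rho>" "\<exists>y. (y, x) \<in> \<rho>" if "x \<in> carrier A" for x
    using r(1) that by (auto dest: refl_onD)
  show "(x, x') \<in> \<rho> \<longleftrightarrow> (y, y') \<in> \<rho>" if "(x, y) \<in> \<rho>" "(x', y') \<in> \<rho>" for x y x' y'
    using that r(2,3) by (meson symD transD)
qed (rule Con_oper[OF \<rho>])

lemma push_pull:
  assumes "f ` carrier A = carrier B" "\<rho> \<subseteq> carrier B \<times> carrier B"
  shows "push f (pull A f \<rho>) = \<rho>"
proof
  show "\<rho> \<subseteq> push f (pull A f \<rho>)"
  proof (rule subrelI)
    fix u v assume uv: "(u, v) \<in> \<rho>"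
    then have "u \<in> f ` carrier A" "v \<in> f ` carrier A" using assms by auto
    with uv show "(u, v) \<in> push f (pull A f \<rho>)" by (auto simp: push_def pull_def)
  qed
qed (auto simp: push_def pull_def)

lemma con_quot_eq_push: "con_quot e \<nu> \<theta> = push (cls e \<theta>) \<nu>"
  by (simp add: con_quot_def push_def)

text \<open>The correspondence theorem, first half: a congruence above the kernel is a union of
  products of fibres of \<open>p\<close>, so it can be recovered from its image.\<close>

lemma pull_push:
  assumes p: "quotient_hom \<tau> A P p \<theta>" and \<nu>: "\<nu> \<in> Con \<tau> A" "\<theta> \<subseteq> \<nu>"
  shows "pull A p (push p \<nu>) = \<nu>"
proof
  have sub: "\<nu> \<subseteq> carrier A \<times> carrier A" using \<nu>(1) by (rule Con_subset)
  show "\<nu> \<subseteq> pull A p (push p \<nu>)"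
    using sub by (auto simp: pull_def push_def)
  show "pull A p (push p \<nu>) \<subseteq> \<nu>"
  proof (rule subrelI)
    fix x y assume "(x, y) \<in> pull A p (push p \<nu>)"
    then obtain x' y' where xy: "x \<in> carrier A" "y \<in> carrier A" "(x', y') \<in> \<nu>"
      "p x = p x'" "p y = p y'" by (auto simp: pull_def push_def)
    with sub have "x' \<in> carrier A" "y' \<in> carrier A" by auto
    with xy p have "(x, x') \<in> \<theta>" "(y', y) \<in> \<theta>" by (auto simp: quotient_hom_def)
    moreover have "trans \<nu>" using \<nu>(1) by (auto simp: Con_def elim: equivE)
    ultimately show "(x, y) \<in> \<nu>" using xy(3) \<nu>(2) unfolding trans_def by blast
  qed
qed

section \<open>Transport of congruences along an isomorphism onto a quotient\<close>

text \<open>For \<open>g : B \<cong> A/\<theta>\<close> this is the congruence above \<open>\<theta>\<close> whose image in \<open>A/\<theta>\<close> is the image of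
  \<open>\<rho>\<close> under \<open>g\<close>. With \<open>B = A\<close> it is \<open>fhat\<close> (\<open>fhat_eq_transport\<close>); the general form is what
  composes two isomorphisms between \<open>A\<close> and \<open>B\<close>.\<close>

definition transport ::
  "('u set \<Rightarrow> 'u) \<Rightarrow> ('f, 'u) alg \<Rightarrow> ('u \<times> 'u) set \<Rightarrow> ('v \<Rightarrow> 'u) \<Rightarrow> ('v \<times> 'v) set
   \<Rightarrow> ('u \<times> 'u) set" where
  "transport e A \<theta> g \<rho> = pull A (cls e \<theta>) (push g \<rho>)"

locale boolean_presheaf =
  fixes \<tau> :: "'f alg_type" and e :: "'u set \<Rightarrow> 'u" and \<A> :: "('f, 'u) alg set"
    and \<K> :: "('f, 'u) alg \<Rightarrow> ('u \<times> 'u) set set"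
  assumes category: "category_of_algebras \<tau> \<A>"
    and naming: "class_naming \<tau> \<A> e"
    and presheaf: "boolean_factor_congruences_presheaf \<tau> e \<A> \<K>"
begin

lemma algebra: "A \<in> \<A> \<Longrightarrow> algebra \<tau> A"
  using category by (simp add: category_of_algebras_def)

lemma K_Con: "A \<in> \<A> \<Longrightarrow> \<theta> \<in> \<K> A \<Longrightarrow> \<theta> \<in> Con \<tau> A"
  using presheaf
  unfolding boolean_factor_congruences_presheaf_def congruences_presheaf_def
    congruences_operator_def by blast

lemma quot_in_category: "A \<in> \<A> \<Longrightarrow> \<sigma> \<in> \<K> A \<Longrightarrow> quot \<tau> e A \<sigma> \<in> \<A>"
  using presheaf
  unfolding boolean_factor_congruences_presheaf_def congruences_presheaf_def
    congruences_operator_def by blast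

lemma pull_iso_bij:
  "A \<in> \<A> \<Longrightarrow> B \<in> \<A> \<Longrightarrow> is_iso \<tau> A B f \<Longrightarrow> bij_betw (pull A f) (\<K> B) (\<K> A)"
  using presheaf
  unfolding boolean_factor_congruences_presheaf_def congruences_presheaf_def
    congruences_operator_def by blast

lemma K_above_iff:
  "A \<in> \<A> \<Longrightarrow> \<sigma> \<in> \<K> A \<Longrightarrow> \<theta> \<in> con_interval \<tau> A \<sigma> (Nabla A) \<Longrightarrow>
   \<theta> \<in> \<K> A \<longleftrightarrow> con_quot e \<theta> \<sigma> \<in> \<K> (quot \<tau> e A \<sigma>)"
  using presheaf
  unfolding boolean_factor_congruences_presheaf_def congruences_presheaf_def by blast

lemma quotient_hom_K:
  "A \<in> \<A> \<Longrightarrow> \<sigma> \<in> \<K> A \<Longrightarrow> quotient_hom \<tau> A (quot \<tau> e A \<sigma>) (cls e \<sigma>) \<sigma>"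
  using naming by (intro quotient_hom_quot algebra K_Con) (auto simp: class_naming_def K_Con)

lemma K_above_interval:
  "A \<in> \<A> \<Longrightarrow> \<nu> \<in> \<K> A \<Longrightarrow> \<theta> \<subseteq> \<nu> \<Longrightarrow> \<nu> \<in> con_interval \<tau> A \<theta> (Nabla A)"
  using Con_subset[OF K_Con] by (auto simp: con_interval_def Nabla_def K_Con)

text \<open>The axiom on isomorphisms speaks of inverse images. Since every member of \<open>\<K> A\<close> is
  one, direct images behave in the same way.\<close>

lemma push_in_K:
  assumes "A \<in> \<A>" "B \<in> \<A>" "is_iso \<tau> A B f" "\<rho> \<in> \<K> A"
  shows "push f \<rho> \<in> \<K> B"
proof -
  obtain \<xi> where \<xi>: "\<xi> \<in> \<K> B" "\<rho> = pull A f \<xi>"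
    using pull_iso_bij[OF assms(1-3)] assms(4) by (auto simp: bij_betw_def)
  have "push f \<rho> = \<xi>"
    unfolding \<xi>(2) using assms Con_subset[OF K_Con] \<xi>
    by (intro push_pull) (auto simp: is_iso_def bij_betw_def)
  with \<xi> show ?thesis by simp
qed

lemma con_quot_transport:
  assumes A: "A \<in> \<A>" and \<theta>: "\<theta> \<in> \<K> A" and B: "B \<in> \<A>"
    and g: "is_iso \<tau> B (quot \<tau> e A \<theta>) g" and \<rho>: "\<rho> \<in> \<K> B"
  shows "con_quot e (transport e A \<theta> g \<rho>) \<theta> = push g \<rho>"
  unfolding con_quot_eq_push transport_def
  using push_in_K[OF B quot_in_category[OF A \<theta>] g \<rho>]
  by (intro push_pull[OF cls_image_carrier[of e \<theta> A \<tau>]] Con_subset[OF K_Con[OF quot_in_category[OF A \<theta>]]])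

lemma transport_interval:
  assumes A: "A \<in> \<A>" and \<theta>: "\<theta> \<in> \<K> A" and B: "B \<in> \<A>"
    and g: "is_iso \<tau> B (quot \<tau> e A \<theta>) g" and \<rho>: "\<rho> \<in> \<K> B"
  shows "transport e A \<theta> g \<rho> \<in> con_interval \<tau> A \<theta> (Nabla A)"
proof -
  let ?Q = "quot \<tau> e A \<theta>"
  have Q: "?Q \<in> \<A>" using A \<theta> by (rule quot_in_category)
  have q: "quotient_hom \<tau> A ?Q (cls e \<theta>) \<theta>" using A \<theta> by (rule quotient_hom_K)
  have \<xi>: "push g \<rho> \<in> Con \<tau> ?Q" by (intro K_Con[OF Q] push_in_K[OF B Q g \<rho>])
  have "transport e A \<theta> g \<rho> \<in> Con \<tau> A"
    unfolding transport_def
    using pull_in_Con[OF algebra[OF A] _ \<xi>] q by (simp add: quotient_hom_def)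
  moreover have "\<theta> \<subseteq> transport e A \<theta> g \<rho>"
  proof (rule subrelI)
    fix x y assume xy: "(x, y) \<in> \<theta>"
    with Con_subset[OF K_Con[OF A \<theta>]] have mem: "x \<in> carrier A" "y \<in> carrier A" by auto
    with q xy have "cls e \<theta> x = cls e \<theta> y" "cls e \<theta> x \<in> carrier ?Q"
      by (auto simp: quotient_hom_def)
    moreover have "refl_on (carrier ?Q) (push g \<rho>)"
      using \<xi> by (auto simp: Con_def elim: equivE)
    ultimately show "(x, y) \<in> transport e A \<theta> g \<rho>"
      using mem by (auto simp: transport_def pull_def refl_on_def)
  qed
  ultimately show ?thesis
    using Con_subset[of "transport e A \<theta> g \<rho>"] by (simp add: con_interval_def Nabla_def)
qed

lemma transport_in_K:
  assumes A: "A \<in> \<A>" and \<theta>: "\<theta> \<in> \<K> A" and B: "B \<in> \<A>"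
    and g: "is_iso \<tau> B (quot \<tau> e A \<theta>) g" and \<rho>: "\<rho> \<in> \<K> B"
  shows "transport e A \<theta> g \<rho> \<in> \<K> A" "\<theta> \<subseteq> transport e A \<theta> g \<rho>"
  using transport_interval[OF assms] con_quot_transport[OF assms]
    push_in_K[OF B quot_in_category[OF A \<theta>] g \<rho>] K_above_iff[OF A \<theta>]
  by (auto simp: con_interval_def)

lemma transport_surj:
  assumes A: "A \<in> \<A>" and \<theta>: "\<theta> \<in> \<K> A" and B: "B \<in> \<A>"
    and g: "is_iso \<tau> B (quot \<tau> e A \<theta>) g" and \<nu>: "\<nu> \<in> \<K> A" "\<theta> \<subseteq> \<nu>"
  obtains \<rho> where "\<rho> \<in> \<K> B" "transport e A \<theta> g \<rho> = \<nu>"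
proof
  let ?Q = "quot \<tau> e A \<theta>" and ?\<xi> = "con_quot e \<nu> \<theta>"
  have Q: "?Q \<in> \<A>" using A \<theta> by (rule quot_in_category)
  have \<xi>: "?\<xi> \<in> \<K> ?Q"
    using K_above_iff[OF A \<theta> K_above_interval[OF A \<nu>]] \<nu> by blast
  show "pull B g ?\<xi> \<in> \<K> B"
    using pull_iso_bij[OF B Q g] \<xi> by (auto simp: bij_betw_def)
  have "push g (pull B g ?\<xi>) = ?\<xi>"
    using g Con_subset[OF K_Con[OF Q \<xi>]]
    by (intro push_pull) (auto simp: is_iso_def bij_betw_def)
  then show "transport e A \<theta> g (pull B g ?\<xi>) = \<nu>"
    unfolding transport_def
    using pull_push[OF quotient_hom_K[OF A \<theta>] K_Con[OF A \<nu>(1)] \<nu>(2)]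
    by (simp add: con_quot_eq_push)
qed

text \<open>This is the third isomorphism theorem in relational form: \<open>g\<close> induces
  \<open>B/\<rho> \<cong> A/transport \<rho>\<close>, and one relation serves for all \<open>\<rho>\<close>.\<close>

lemma correspondence_transport:
  assumes A: "A \<in> \<A>" and \<theta>: "\<theta> \<in> \<K> A" and B: "B \<in> \<A>"
    and g: "is_iso \<tau> B (quot \<tau> e A \<theta>) g" and \<rho>: "\<rho> \<in> \<K> B"
  shows "correspondence \<tau> B \<rho> A (transport e A \<theta> g \<rho>)
    {(b, a). b \<in> carrier B \<and> a \<in> carrier A \<and> g b = cls e \<theta> a}"
    (is "correspondence _ _ _ _ _ ?R")
proof -
  have R: "correspondence \<tau> B (Delta B) A \<theta> ?R"
    using correspondence_of_iso[OF algebra algebra quotient_hom_id quotient_hom_K g] A B \<theta>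
    by simp
  have inj: "inj_on g (carrier B)" using g by (simp add: is_iso_def bij_betw_def)
  have "(b, b') \<in> \<rho> \<longleftrightarrow> (a, a') \<in> transport e A \<theta> g \<rho>"
    if ba: "(b, a) \<in> ?R" "(b', a') \<in> ?R" for a a' b b'
  proof -
    have "(a, a') \<in> transport e A \<theta> g \<rho> \<longleftrightarrow> (g b, g b') \<in> push g \<rho>"
      using ba by (simp add: transport_def pull_def)
    also have "\<dots> \<longleftrightarrow> (\<exists>c c'. (c, c') \<in> \<rho> \<and> g b = g c \<and> g b' = g c')"
      by (auto simp: push_def)
    also have "\<dots> \<longleftrightarrow> (b, b') \<in> \<rho>"
      using Con_subset[OF K_Con[OF B \<rho>]] inj ba unfolding inj_on_def by blast
    finally show ?thesis by simp
  qed
  then show ?thesis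
    by (intro correspondenceI correspondenceD(1-4)[OF R])
qed

text \<open>Both congruences are matched with their transports by the same total relation, so inclusions
  can be read off on either side.\<close>

lemma transport_subset_iff:
  assumes A: "A \<in> \<A>" and \<theta>: "\<theta> \<in> \<K> A" and B: "B \<in> \<A>"
    and g: "is_iso \<tau> B (quot \<tau> e A \<theta>) g" and \<rho>: "\<rho> \<in> \<K> B" "\<rho>' \<in> \<K> B"
  shows "transport e A \<theta> g \<rho> \<subseteq> transport e A \<theta> g \<rho>' \<longleftrightarrow> \<rho> \<subseteq> \<rho>'"
proof
  show "transport e A \<theta> g \<rho> \<subseteq> transport e A \<theta> g \<rho>'" if "\<rho> \<subseteq> \<rho>'"
    using that by (auto simp: transport_def pull_def push_def)
next
  assume sub: "transport e A \<theta> g \<rho> \<subseteq> transport e A \<theta> g \<rho>'"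
  show "\<rho> \<subseteq> \<rho>'"
  proof (rule subrelI)
    fix b b' assume bb: "(b, b') \<in> \<rho>"
    let ?R = "{(b, a). b \<in> carrier B \<and> a \<in> carrier A \<and> g b = cls e \<theta> a}"
    note c = correspondence_transport[OF A \<theta> B g \<rho>(1)] correspondence_transport[OF A \<theta> B g \<rho>(2)]
    have "b \<in> carrier B" "b' \<in> carrier B"
      using bb Con_subset[OF K_Con[OF B \<rho>(1)]] by auto
    then obtain a a' where a: "(b, a) \<in> ?R" "(b', a') \<in> ?R"
      using correspondence_total[OF c(1)] by blast
    then have "(a, a') \<in> transport e A \<theta> g \<rho>"
      using bb correspondence_match[OF c(1)] by blast
    with sub have "(a, a') \<in> transport e A \<theta> g \<rho>'" by blast
    with a show "(b, b') \<in> \<rho>'"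
      using correspondence_match[OF c(2)] by blast
  qed
qed

lemma fhat_eq_transport:
  assumes A: "A \<in> \<A>" and \<theta>: "\<theta> \<in> \<K> A"
    and f: "is_iso \<tau> A (quot \<tau> e A \<theta>) f" and \<rho>: "\<rho> \<in> \<K> A"
  shows "fhat \<tau> e A f \<theta> \<rho> = transport e A \<theta> f \<rho>"
  unfolding fhat_def
proof (rule the_equality)
  show "transport e A \<theta> f \<rho> \<in> con_interval \<tau> A \<theta> (Nabla A) \<and>
      con_quot e (transport e A \<theta> f \<rho>) \<theta> = push f \<rho>"
    using transport_interval[OF A \<theta> A f \<rho>] con_quot_transport[OF A \<theta> A f \<rho>] by blast
next
  fix \<nu> assume "\<nu> \<in> con_interval \<tau> A \<theta> (Nabla A) \<and> con_quot e \<nu> \<theta> = push f \<rho>"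
  then show "\<nu> = transport e A \<theta> f \<rho>"
    using pull_push[OF quotient_hom_K[OF A \<theta>], of \<nu>]
    by (simp add: transport_def con_interval_def con_quot_eq_push)
qed

lemma K_boolean:
  assumes "A \<in> \<A>"
  shows "Delta A \<in> \<K> A" "Nabla A \<in> \<K> A"
    and "x \<in> \<K> A \<Longrightarrow> y \<in> \<K> A \<Longrightarrow> x \<inter> y \<in> \<K> A"
    and "x \<in> \<K> A \<Longrightarrow> y \<in> \<K> A \<Longrightarrow> con_join \<tau> A x y \<in> \<K> A"
    and "x \<in> \<K> A \<Longrightarrow> y \<in> \<K> A \<Longrightarrow> z \<in> \<K> A \<Longrightarrow>
      x \<inter> con_join \<tau> A y z = con_join \<tau> A (x \<inter> y) (x \<inter> z)"
proof -
  obtain neg where "boolean_sublattice \<tau> A (\<K> A) neg"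
    using presheaf assms unfolding boolean_factor_congruences_presheaf_def by meson
  then show "Delta A \<in> \<K> A" "Nabla A \<in> \<K> A"
    and "x \<in> \<K> A \<Longrightarrow> y \<in> \<K> A \<Longrightarrow> x \<inter> y \<in> \<K> A"
    and "x \<in> \<K> A \<Longrightarrow> y \<in> \<K> A \<Longrightarrow> con_join \<tau> A x y \<in> \<K> A"
    and "x \<in> \<K> A \<Longrightarrow> y \<in> \<K> A \<Longrightarrow> z \<in> \<K> A \<Longrightarrow>
      x \<inter> con_join \<tau> A y z = con_join \<tau> A (x \<inter> y) (x \<inter> z)"
    by (simp_all add: boolean_sublattice_def)
qed

lemma factor_complement:
  assumes "A \<in> \<A>" "x \<in> \<K> A"
  obtains y where "y \<in> \<K> A" "factor_pair \<tau> A x y"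
proof -
  obtain neg where "\<forall>\<theta>\<in>\<K> A. factor_pair \<tau> A \<theta> (neg \<theta>)" "boolean_sublattice \<tau> A (\<K> A) neg"
    using presheaf assms(1) unfolding boolean_factor_congruences_presheaf_def by meson
  then show ?thesis using assms(2) by (intro that[of "neg x"]) (simp_all add: boolean_sublattice_def)
qed

end

lemma join_upper: "x \<subseteq> con_join \<tau> A x y" "y \<subseteq> con_join \<tau> A x y"
  by (auto simp: con_join_def)

lemma join_least: "z \<in> Con \<tau> A \<Longrightarrow> x \<subseteq> z \<Longrightarrow> y \<subseteq> z \<Longrightarrow> con_join \<tau> A x y \<subseteq> z"
  by (auto simp: con_join_def)

lemma join_absorb: "y \<in> Con \<tau> A \<Longrightarrow> x \<subseteq> y \<Longrightarrow> con_join \<tau> A x y = y"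
  by (simp add: join_least join_upper subset_antisym)

lemma Delta_subset: "\<rho> \<in> Con \<tau> A \<Longrightarrow> Delta A \<subseteq> \<rho>"
  by (auto simp: Con_def Delta_def elim: equivE dest: refl_onD)

lemma subset_Nabla: "\<rho> \<in> Con \<tau> A \<Longrightarrow> \<rho> \<subseteq> Nabla A"
  unfolding Nabla_def by (rule Con_subset)

lemma Nabla_subset_join:
  assumes "factor_pair \<tau> A x y"
  shows "Nabla A \<subseteq> con_join \<tau> A x y"
proof -
  have "x O y \<subseteq> \<rho>" if "\<rho> \<in> Con \<tau> A" "x \<subseteq> \<rho>" "y \<subseteq> \<rho>" for \<rho>
  proof -
    have "trans \<rho>" using that(1) by (auto simp: Con_def elim: equivE)
    with that show ?thesis unfolding trans_def by blast
  qed
  with assms show ?thesis by (auto simp: con_join_def factor_pair_def)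
qed

section \<open>CBS-sequences and their infima\<close>

locale cbs = boolean_presheaf \<tau> e \<A> \<K>
  for \<tau> :: "'f alg_type" and e :: "'u set \<Rightarrow> 'u" and \<A> :: "('f, 'u) alg set"
    and \<K> :: "('f, 'u) alg \<Rightarrow> ('u \<times> 'u) set set" +
  fixes A \<theta> f
  assumes A: "A \<in> \<A>" and \<theta>: "\<theta> \<in> \<K> A" and f: "is_iso \<tau> A (quot \<tau> e A \<theta>) f"
begin

abbreviation \<phi> where "\<phi> \<equiv> fhat \<tau> e A f \<theta>"
abbreviation join (infixl "\<squnion>" 65) where "x \<squnion> y \<equiv> con_join \<tau> A x y"

lemmas con = K_Con[OF A]
lemmas K_closed = K_boolean(1-4)[OF A]
lemmas distrib = K_boolean(5)[OF A]
lemmas bot = Delta_subset[OF con]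
lemmas top = subset_Nabla[OF con]

lemma fhat_K: "\<rho> \<in> \<K> A \<Longrightarrow> \<phi> \<rho> \<in> \<K> A" "\<rho> \<in> \<K> A \<Longrightarrow> \<theta> \<subseteq> \<phi> \<rho>"
  using transport_in_K[OF A \<theta> A f] by (simp_all add: fhat_eq_transport[OF A \<theta> f])

lemma fhat_subset_iff: "\<rho> \<in> \<K> A \<Longrightarrow> \<rho>' \<in> \<K> A \<Longrightarrow> \<phi> \<rho> \<subseteq> \<phi> \<rho>' \<longleftrightarrow> \<rho> \<subseteq> \<rho>'"
  using transport_subset_iff[OF A \<theta> A f] by (simp add: fhat_eq_transport[OF A \<theta> f])

lemma fhat_surj:
  assumes "\<nu> \<in> \<K> A" "\<theta> \<subseteq> \<nu>"
  obtains \<rho> where "\<rho> \<in> \<K> A" "\<phi> \<rho> = \<nu>"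
  using transport_surj[OF A \<theta> A f assms] fhat_eq_transport[OF A \<theta> f] by metis

lemma fhat_inj: "inj_on \<phi> (\<K> A)"
  by (rule inj_onI) (metis fhat_subset_iff order_refl subset_antisym)

text \<open>The join of two members of the upper part of \<open>\<K> A\<close> lies in that part again, so an order
  isomorphism onto it preserves joins.\<close>

lemma fhat_join:
  assumes x: "x \<in> \<K> A" and y: "y \<in> \<K> A"
  shows "\<phi> (x \<squnion> y) = \<phi> x \<squnion> \<phi> y"
proof
  have j: "\<phi> x \<squnion> \<phi> y \<in> \<K> A" by (intro K_closed fhat_K x y)
  moreover have "\<theta> \<subseteq> \<phi> x \<squnion> \<phi> y" using fhat_K(2)[OF x] join_upper(1) by fast
  ultimately obtain z where z: "z \<in> \<K> A" "\<phi> z = \<phi> x \<squnion> \<phi> y" by (rule fhat_surj)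
  then have "x \<subseteq> z" "y \<subseteq> z" using join_upper fhat_subset_iff x y by metis+
  then have "x \<squnion> y \<subseteq> z" using z con by (intro join_least) auto
  then show "\<phi> (x \<squnion> y) \<subseteq> \<phi> x \<squnion> \<phi> y"
    using fhat_subset_iff[OF K_closed(4)[OF x y] z(1)] z(2) by simp
  show "\<phi> x \<squnion> \<phi> y \<subseteq> \<phi> (x \<squnion> y)"
    using x y K_closed(4)[OF x y] con
    by (intro join_least) (auto simp: fhat_subset_iff fhat_K join_upper[THEN subsetD])
qed

lemma fhat_Delta: "\<phi> (Delta A) = \<theta>"
proof
  obtain \<rho> where \<rho>: "\<rho> \<in> \<K> A" "\<phi> \<rho> = \<theta>" using fhat_surj[OF \<theta> order_refl] .
  then show "\<phi> (Delta A) \<subseteq> \<theta>"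
    using fhat_subset_iff[OF K_closed(1) \<rho>(1)] bot[OF \<rho>(1)] by simp
qed (rule fhat_K(2)[OF K_closed(1)])

lemma fhat_Nabla: "\<phi> (Nabla A) = Nabla A"
proof
  obtain \<rho> where \<rho>: "\<rho> \<in> \<K> A" "\<phi> \<rho> = Nabla A"
    using fhat_surj[OF K_closed(2) top[OF \<theta>]] .
  then show "Nabla A \<subseteq> \<phi> (Nabla A)"
    using fhat_subset_iff[OF \<rho>(1) K_closed(2)] top[OF \<rho>(1)] by simp
qed (intro top fhat_K K_closed)

text \<open>Relative to the interval above \<open>\<theta>\<close>, the complement of \<open>\<phi> \<zeta>\<close> is \<open>\<theta> \<squnion> \<nu>\<close>. Since \<open>\<phi>\<close> maps \<open>\<K> A\<close>
  isomorphically onto its part above \<open>\<theta>\<close>, with \<open>\<phi> \<Delta> = \<theta>\<close>, it reflects this complementation.\<close>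

lemma preimage_complement:
  assumes \<zeta>: "\<zeta> \<in> \<K> A" and \<nu>: "\<nu> \<in> \<K> A" and pair: "factor_pair \<tau> A (\<phi> \<zeta>) \<nu>"
    and \<eta>: "\<eta> \<in> \<K> A" "\<phi> \<eta> = \<theta> \<squnion> \<nu>"
  shows "\<zeta> \<inter> \<eta> = Delta A" "Nabla A \<subseteq> \<zeta> \<squnion> \<eta>"
proof -
  have m: "\<zeta> \<inter> \<eta> \<in> \<K> A" and j: "\<zeta> \<squnion> \<eta> \<in> \<K> A" by (intro K_closed \<zeta> \<eta>)+
  have "\<phi> (\<zeta> \<inter> \<eta>) \<subseteq> \<phi> \<zeta> \<inter> \<phi> \<eta>"
    using fhat_subset_iff[OF m \<zeta>] fhat_subset_iff[OF m \<eta>(1)] by simp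
  also have "\<phi> \<zeta> \<inter> \<phi> \<eta> = (\<phi> \<zeta> \<inter> \<theta>) \<squnion> (\<phi> \<zeta> \<inter> \<nu>)"
    unfolding \<eta>(2) by (intro distrib fhat_K \<zeta> \<theta> \<nu>)
  also have "\<dots> \<subseteq> \<theta>"
    using pair bot[OF \<theta>] con[OF \<theta>]
    by (intro join_least) (auto simp: factor_pair_def)
  finally have "\<zeta> \<inter> \<eta> \<subseteq> Delta A"
    using fhat_subset_iff[OF m K_closed(1)] by (simp add: fhat_Delta)
  then show "\<zeta> \<inter> \<eta> = Delta A"
    using bot[OF m] by blast
  have "\<nu> \<subseteq> \<phi> \<eta>" by (simp add: \<eta>(2) join_upper)
  also have "\<phi> \<eta> \<subseteq> \<phi> \<zeta> \<squnion> \<phi> \<eta>" by (rule join_upper)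
  finally have "\<phi> \<zeta> \<squnion> \<nu> \<subseteq> \<phi> \<zeta> \<squnion> \<phi> \<eta>"
    by (intro join_least con K_closed fhat_K \<zeta> \<eta> join_upper(1))
  then have "\<phi> (Nabla A) \<subseteq> \<phi> (\<zeta> \<squnion> \<eta>)"
    using Nabla_subset_join[OF pair] fhat_join[OF \<zeta> \<eta>(1)] by (simp add: fhat_Nabla)
  then show "Nabla A \<subseteq> \<zeta> \<squnion> \<eta>"
    using fhat_subset_iff[OF K_closed(2) j] by simp
qed

text \<open>What the gluing argument uses of a CBS-sequence: it is the orbit under \<open>\<phi>\<close> of a complement
  of \<open>\<zeta>\<close>. The complements at later indices are \<open>\<phi>\<close>-images by definition, and \<open>\<phi>\<close> commutes
  with the joins.\<close>

lemma CBS_sequence_shift: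
  assumes \<zeta>: "\<zeta> \<in> \<K> A" and s: "CBS_sequence \<tau> e \<K> A f \<theta> \<zeta> s"
  shows "s n \<in> \<K> A" "s (Suc n) = \<phi> (s n)"
    and "\<zeta> \<inter> s 0 = Delta A" "Nabla A \<subseteq> \<zeta> \<squnion> s 0"
proof -
  obtain \<nu> where \<nu>: "\<nu> \<in> \<K> A" "factor_pair \<tau> A (\<phi> \<zeta>) \<nu>"
    and s_eq: "\<And>n. s n = cbs_sigma \<tau> e A f \<theta> \<zeta> (2 * n) \<squnion> cbs_neg \<tau> e \<K> A f \<theta> \<nu> n"
    using s by (auto simp: CBS_sequence_def)
  obtain \<rho> where "\<rho> \<in> \<K> A" "\<phi> \<rho> = \<theta> \<squnion> \<nu>"
    using fhat_surj[OF K_closed(4)[OF \<theta> \<nu>(1)] join_upper(1)] .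
  then have "\<theta> \<squnion> \<nu> \<in> \<phi> ` \<K> A" by force
  then have \<eta>: "cbs_neg \<tau> e \<K> A f \<theta> \<nu> 0 \<in> \<K> A"
      "\<phi> (cbs_neg \<tau> e \<K> A f \<theta> \<nu> 0) = \<theta> \<squnion> \<nu>"
    by (simp_all add: inv_into_into f_inv_into_f)
  have sigma: "cbs_sigma \<tau> e A f \<theta> \<zeta> (2 * n) \<in> \<K> A" for n
    by (induction n) (auto intro: K_closed fhat_K)
  have neg: "cbs_neg \<tau> e \<K> A f \<theta> \<nu> n \<in> \<K> A" for n
    by (induction n) (use \<eta>(1) in \<open>auto intro: fhat_K\<close>)
  show "s n \<in> \<K> A" unfolding s_eq by (intro K_closed sigma neg)
  show "s (Suc n) = \<phi> (s n)"
    unfolding s_eq by (simp add: fhat_join sigma neg)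
  have "s 0 = cbs_neg \<tau> e \<K> A f \<theta> \<nu> 0"
    unfolding s_eq using \<eta>(1) con bot by (simp del: cbs_neg.simps(1) add: join_absorb)
  then show "\<zeta> \<inter> s 0 = Delta A" "Nabla A \<subseteq> \<zeta> \<squnion> s 0"
    using preimage_complement[OF \<zeta> \<nu> \<eta>] by simp_all
qed

text \<open>The tail is the \<open>\<phi>\<close>-image of the whole sequence, and its infimum lies above \<open>\<theta>\<close>, hence in the
  range of \<open>\<phi>\<close>. An order isomorphism takes the infimum of the whole sequence, which is
  \<open>\<iota> \<inter> s 0\<close>, to the infimum of the image.\<close>

lemma infimum_shift:
  assumes \<zeta>: "\<zeta> \<in> \<K> A" and s: "CBS_sequence \<tau> e \<K> A f \<theta> \<zeta> s"
    and \<iota>: "isGlb (\<K> A) (s ` {1..}) \<iota>"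
  shows "\<iota> \<in> \<K> A" "\<theta> \<subseteq> \<iota>" "\<phi> (\<iota> \<inter> s 0) = \<iota>"
proof -
  note S = CBS_sequence_shift[OF \<zeta> s]
  show \<iota>K: "\<iota> \<in> \<K> A" using \<iota> by (simp add: isGlb_def greatestP_def isLb_def)
  have lower: "\<iota> \<subseteq> s (Suc n)" for n
    using \<iota> by (auto simp: isGlb_def greatestP_def isLb_def setge_def)
  have greatest: "x \<subseteq> \<iota>" if "x \<in> \<K> A" "\<And>n. x \<subseteq> s (Suc n)" for x
  proof -
    have "x \<subseteq> s n" if "n \<ge> 1" for n
      using \<open>\<And>n. x \<subseteq> s (Suc n)\<close>[of "n - 1"] \<open>n \<ge> 1\<close> by simp
    with \<open>x \<in> \<K> A\<close> \<iota> show ?thesis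
      by (auto simp: isGlb_def greatestP_def isLb_def setge_def setle_def)
  qed
  show \<theta>\<iota>: "\<theta> \<subseteq> \<iota>" using greatest[OF \<theta>] S(1,2) fhat_K(2) by simp
  obtain \<kappa> where \<kappa>: "\<kappa> \<in> \<K> A" "\<phi> \<kappa> = \<iota>" using fhat_surj[OF \<iota>K \<theta>\<iota>] .
  have below: "\<kappa> \<subseteq> s n" for n
    using lower[of n] S(1,2) \<kappa> fhat_subset_iff by metis
  have m: "\<iota> \<inter> s 0 \<in> \<K> A" by (intro K_closed \<iota>K S(1))
  have "\<kappa> = \<iota> \<inter> s 0"
  proof
    show "\<kappa> \<subseteq> \<iota> \<inter> s 0" using below greatest[OF \<kappa>(1)] by simp
    have "\<iota> \<inter> s 0 \<subseteq> s n" for n using lower by (cases n) auto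
    then have "\<phi> (\<iota> \<inter> s 0) \<subseteq> \<iota>"
      using fhat_subset_iff[OF m S(1)] S(2) by (intro greatest fhat_K m) auto
    then show "\<iota> \<inter> s 0 \<subseteq> \<kappa>" using \<kappa> fhat_subset_iff m by metis
  qed
  with \<kappa> show "\<phi> (\<iota> \<inter> s 0) = \<iota>" by simp
qed

text \<open>Distributivity computes \<open>\<not>(\<iota> \<inter> \<not>\<zeta>) = \<not>\<iota> \<squnion> \<zeta>\<close>, and meeting with \<open>\<iota>\<close> leaves \<open>\<iota> \<inter> \<zeta> = \<zeta>\<close>.\<close>

lemma meet_complement_eq:
  assumes \<zeta>: "\<zeta> \<in> \<K> A" and \<eta>: "\<eta> \<in> \<K> A" "\<zeta> \<inter> \<eta> = Delta A" "Nabla A \<subseteq> \<zeta> \<squnion> \<eta>"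
    and \<iota>: "\<iota> \<in> \<K> A" "\<zeta> \<subseteq> \<iota>" and c: "c \<in> \<K> A" "factor_pair \<tau> A (\<iota> \<inter> \<eta>) c"
  shows "\<iota> \<inter> c = \<zeta>"
proof
  have "\<iota> \<inter> c \<subseteq> (\<iota> \<inter> c) \<inter> (\<zeta> \<squnion> \<eta>)"
    using \<eta>(3) top[OF \<iota>(1)] by blast
  also have "\<dots> = (\<iota> \<inter> c \<inter> \<zeta>) \<squnion> (\<iota> \<inter> c \<inter> \<eta>)"
    by (intro distrib K_closed \<iota> c \<zeta> \<eta>)
  also have "\<dots> \<subseteq> \<zeta>"
  proof (intro join_least con \<zeta>)
    show "\<iota> \<inter> c \<inter> \<eta> \<subseteq> \<zeta>"
      using c(2) bot[OF \<zeta>] unfolding factor_pair_def by blast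
  qed blast
  finally show "\<iota> \<inter> c \<subseteq> \<zeta>" .
  have "\<zeta> \<subseteq> \<zeta> \<inter> ((\<iota> \<inter> \<eta>) \<squnion> c)"
    using Nabla_subset_join[OF c(2)] top[OF \<zeta>] by blast
  also have "\<dots> = (\<zeta> \<inter> (\<iota> \<inter> \<eta>)) \<squnion> (\<zeta> \<inter> c)"
    by (intro distrib K_closed \<iota> c \<zeta> \<eta>)
  also have "\<dots> \<subseteq> c"
    using \<eta>(2) bot[OF c(1)] by (intro join_least con c) blast+
  finally show "\<zeta> \<subseteq> \<iota> \<inter> c" using \<iota>(2) by blast
qed

text \<open>Related \<open>x\<close> and \<open>y\<close> have the same component in \<open>A/c\<close>, and \<open>f\<close> takes the component of \<open>x\<close> in
  \<open>A/\<kappa>\<close> to that of \<open>y\<close> in \<open>A/\<phi> \<kappa>\<close>. Given one of \<open>x\<close> and \<open>y\<close>, the other is found by prescribing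
  both components, which \<open>\<kappa> O c = \<nabla>\<close> permits: directly if \<open>x\<close> is sought, and because \<open>\<kappa> \<subseteq> \<phi> \<kappa>\<close>
  if \<open>y\<close> is sought.\<close>

lemma correspondence_gluing:
  assumes \<kappa>: "\<kappa> \<in> \<K> A" "\<kappa> \<subseteq> \<phi> \<kappa>" and c: "factor_pair \<tau> A \<kappa> c"
  shows "\<exists>R. correspondence \<tau> A (Delta A) A (\<phi> \<kappa> \<inter> c) R"
proof
  define F where "F = {(x, y). x \<in> carrier A \<and> y \<in> carrier A \<and> f x = cls e \<theta> y}"
  define G where "G = F O \<phi> \<kappa>"
  have \<phi>\<kappa>: "\<phi> \<kappa> \<in> Con \<tau> A" by (intro con fhat_K \<kappa>)
  have cc: "c \<in> Con \<tau> A" and \<kappa>c: "\<kappa> \<inter> c = Delta A" "\<kappa> O c = Nabla A" and \<kappa>con: "\<kappa> \<in> Con \<tau> A"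
    using c by (auto simp: factor_pair_def)
  have trans: "trans (\<phi> \<kappa>)" and c_eq: "sym c" "trans c" and \<kappa>_eq: "sym \<kappa>"
    using \<phi>\<kappa> cc \<kappa>con by (auto simp: Con_def elim: equivE)
  have "correspondence \<tau> A \<kappa> A (\<phi> \<kappa>) F"
    unfolding F_def fhat_eq_transport[OF A \<theta> f \<kappa>(1)]
    by (rule correspondence_transport[OF A \<theta> A f \<kappa>(1)])
  then have G: "correspondence \<tau> A \<kappa> A (\<phi> \<kappa>) G"
    unfolding G_def by (rule correspondence_comp[OF _ correspondence_Con[OF \<phi>\<kappa>]])
  have G_step: "(x, y) \<in> G" if "(x, z) \<in> G" "(z, y) \<in> \<phi> \<kappa>" for x y z
    using that trans unfolding G_def by (blast dest: transD)
  show "correspondence \<tau> A (Delta A) A (\<phi> \<kappa> \<inter> c) (G \<inter> c)"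
  proof (rule correspondenceI)
    show "G \<inter> c \<subseteq> carrier A \<times> carrier A" using Con_subset[OF cc] by auto
  next
    fix x assume x: "x \<in> carrier A"
    then obtain z where z: "(x, z) \<in> G" using correspondence_total[OF G] by blast
    then have "(z, x) \<in> \<kappa> O c"
      using correspondence_carrier[OF G] x \<kappa>c by (auto simp: Nabla_def)
    then obtain y where y: "(z, y) \<in> \<kappa>" "(y, x) \<in> c" by blast
    then have "(x, y) \<in> G" using G_step[OF z] \<kappa>(2) by blast
    moreover have "(x, y) \<in> c" using c_eq(1) y(2) by (rule symD)
    ultimately show "\<exists>y. (x, y) \<in> G \<inter> c" by blast
  next
    fix y assume y: "y \<in> carrier A"
    then obtain w where w: "(w, y) \<in> G" using correspondence_onto[OF G] by blast
    then have "(w, y) \<in> \<kappa> O c"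
      using correspondence_carrier[OF G] y \<kappa>c by (auto simp: Nabla_def)
    then obtain x where x: "(w, x) \<in> \<kappa>" "(x, y) \<in> c" by blast
    then have "x \<in> carrier A" using Con_subset[OF cc] by auto
    then obtain z where z: "(x, z) \<in> G" using correspondence_total[OF G] by blast
    have "(x, w) \<in> \<kappa>" using \<kappa>_eq x(1) by (rule symD)
    then have "(x, y) \<in> G" using correspondence_match[OF G z w] G_step[OF z] by blast
    with x show "\<exists>x. (x, y) \<in> G \<inter> c" by blast
  next
    fix s xs ys
    assume s: "s \<in> symbols \<tau>" and xs: "xs \<in> args \<tau> A s" and ys: "ys \<in> args \<tau> A s"
      and rel: "list_all2 (\<lambda>x y. (x, y) \<in> G \<inter> c) xs ys"
    have "list_all2 (\<lambda>x y. (x, y) \<in> G) xs ys" "list_all2 (\<lambda>x y. (x, y) \<in> c) xs ys"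
      using rel by (auto elim: list_all2_mono)
    then show "(oper A s xs, oper A s ys) \<in> G \<inter> c"
      using correspondence_oper[OF G s xs ys] Con_oper[OF cc s xs ys] by simp
  next
    fix x y x' y' assume xy: "(x, y) \<in> G \<inter> c" "(x', y') \<in> G \<inter> c"
    have "(x, x') \<in> Delta A \<longleftrightarrow> (x, x') \<in> \<kappa> \<and> (x, x') \<in> c" using \<kappa>c by blast
    also have "(x, x') \<in> \<kappa> \<longleftrightarrow> (y, y') \<in> \<phi> \<kappa>" using correspondence_match[OF G] xy by simp
    also have "(x, x') \<in> c \<longleftrightarrow> (y, y') \<in> c"
      using xy c_eq by (meson IntD2 symD transD)
    finally show "(x, x') \<in> Delta A \<longleftrightarrow> (y, y') \<in> \<phi> \<kappa> \<inter> c" by blast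
  qed
qed

lemma isomorphic_quot_of_infimum:
  assumes \<zeta>: "\<zeta> \<in> \<K> A" "\<zeta> \<subseteq> \<theta>" and s: "CBS_sequence \<tau> e \<K> A f \<theta> \<zeta> s"
    and \<iota>: "isGlb (\<K> A) (s ` {1..}) \<iota>"
  shows "isomorphic \<tau> A (quot \<tau> e A \<zeta>)"
proof -
  note S = CBS_sequence_shift[OF \<zeta>(1) s]
  note I = infimum_shift[OF \<zeta>(1) s \<iota>]
  have \<kappa>: "\<iota> \<inter> s 0 \<in> \<K> A" by (intro K_closed I S)
  obtain c where c: "c \<in> \<K> A" "factor_pair \<tau> A (\<iota> \<inter> s 0) c"
    using factor_complement[OF A \<kappa>] .
  have "\<iota> \<inter> c = \<zeta>"
    using I(1,2) \<zeta> by (intro meet_complement_eq[OF \<zeta>(1) S(1,3,4) _ _ c]) auto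
  with correspondence_gluing[OF \<kappa> _ c(2)] I(3)
  obtain R where "correspondence \<tau> A (Delta A) A \<zeta> R" by auto
  then show ?thesis
    using isomorphic_of_correspondence[OF quotient_hom_id quotient_hom_K[OF A \<zeta>(1)]] by blast
qed

text \<open>For \<open>\<zeta> = \<Delta>\<close> the complement of \<open>\<zeta>\<close> is \<open>\<nabla>\<close>, which \<open>\<phi>\<close> fixes.\<close>

lemma CBS_sequence_Delta: "CBS_sequence \<tau> e \<K> A f \<theta> (Delta A) (\<lambda>n. Nabla A)"
proof -
  obtain \<nu> where \<nu>: "\<nu> \<in> \<K> A" "factor_pair \<tau> A \<theta> \<nu>"
    using factor_complement[OF A \<theta>] .
  have join: "\<theta> \<squnion> \<nu> = Nabla A"
    using Nabla_subset_join[OF \<nu>(2)] top[OF K_closed(4)[OF \<theta> \<nu>(1)]] by blast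
  have "inv_into (\<K> A) \<phi> (Nabla A) = Nabla A"
    using inv_into_f_f[OF fhat_inj K_closed(2)] by (simp add: fhat_Nabla)
  then have neg: "cbs_neg \<tau> e \<K> A f \<theta> \<nu> n = Nabla A" for n
    by (induction n) (simp_all add: join fhat_Nabla)
  have sigma: "cbs_sigma \<tau> e A f \<theta> (Delta A) (2 * n) \<in> \<K> A" for n
    by (induction n) (auto intro: K_closed fhat_K)
  show ?thesis
    unfolding CBS_sequence_def
  proof (intro exI conjI allI)
    show "\<phi> (Delta A) \<in> \<K> A" "factor_pair \<tau> A (\<phi> (Delta A)) \<nu>"
      using \<theta> \<nu> by (simp_all add: fhat_Delta)
    show "Nabla A = cbs_sigma \<tau> e A f \<theta> (Delta A) (2 * n) \<squnion> cbs_neg \<tau> e \<K> A f \<theta> \<nu> n" for n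
      using join_absorb[OF con[OF K_closed(2)] top[OF sigma]] by (simp add: neg)
  qed (rule \<nu>(1))
qed

end

section \<open>The two implications\<close>

context boolean_presheaf
begin

lemma isomorphic_quot_Delta:
  "A \<in> \<A> \<Longrightarrow> isomorphic \<tau> (quot \<tau> e A (Delta A)) A"
  by (rule isomorphic_of_same_kernel[OF algebra quotient_hom_K[OF _ K_boolean(1)] quotient_hom_id])

lemma isomorphic_quot_quot:
  assumes A: "A \<in> \<A>" and \<sigma>: "\<sigma> \<in> \<K> A" and \<theta>: "\<theta> \<in> \<K> A" "\<sigma> \<subseteq> \<theta>"
  shows "isomorphic \<tau> (quot \<tau> e A \<theta>) (quot \<tau> e (quot \<tau> e A \<sigma>) (con_quot e \<theta> \<sigma>))"
proof -
  let ?B = "quot \<tau> e A \<sigma>" and ?\<xi> = "con_quot e \<theta> \<sigma>"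
  have B: "?B \<in> \<A>" using A \<sigma> by (rule quot_in_category)
  have \<xi>: "?\<xi> \<in> \<K> ?B" using K_above_iff[OF A \<sigma> K_above_interval[OF A \<theta>]] \<theta>(1) by blast
  have q: "quotient_hom \<tau> A ?B (cls e \<sigma>) \<sigma>" using A \<sigma> by (rule quotient_hom_K)
  have q': "quotient_hom \<tau> ?B (quot \<tau> e ?B ?\<xi>) (cls e ?\<xi>) ?\<xi>" using B \<xi> by (rule quotient_hom_K)
  have "pull A (cls e \<sigma>) ?\<xi> = \<theta>"
    using pull_push[OF q K_Con[OF A \<theta>(1)] \<theta>(2)] by (simp add: con_quot_eq_push)
  with quotient_hom_comp[OF q q']
  have "quotient_hom \<tau> A (quot \<tau> e ?B ?\<xi>) (cls e ?\<xi> \<circ> cls e \<sigma>) \<theta>" by simp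
  with algebra[OF A] quotient_hom_K[OF A \<theta>(1)] show ?thesis
    by (rule isomorphic_of_same_kernel)
qed

lemma CBS_imp_infimum:
  assumes A: "A \<in> \<A>" and cbs: "CBS_property \<tau> e \<A> \<K> A"
    and \<theta>K: "\<theta> \<in> \<K> A" and f: "is_iso \<tau> A (quot \<tau> e A \<theta>) f"
    and \<sigma>: "\<sigma> \<in> \<K> A" "\<sigma> \<subseteq> \<theta>"
  shows "\<exists>\<zeta>\<in>angle \<tau> e \<K> A \<theta> \<sigma>. \<exists>s. CBS_sequence \<tau> e \<K> A f \<theta> \<zeta> s \<and>
    (\<exists>\<iota>. isGlb (\<K> A) (s ` {1..}) \<iota>)"
proof -
  interpret cbs \<tau> e \<A> \<K> A \<theta> f by unfold_locales (fact A \<theta>K f)+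
  let ?B = "quot \<tau> e A \<sigma>" and ?\<xi> = "con_quot e \<theta> \<sigma>"
  have B: "?B \<in> \<A>" using A \<sigma>(1) by (rule quot_in_category)
  have \<xi>: "?\<xi> \<in> \<K> ?B" using K_above_iff[OF A \<sigma>(1) K_above_interval[OF A \<theta> \<sigma>(2)]] \<theta> by blast
  have "isomorphic \<tau> A (quot \<tau> e ?B ?\<xi>)"
    using isomorphic_trans[OF _ isomorphic_quot_quot[OF A \<sigma>(1) \<theta> \<sigma>(2)]] f
    by (auto simp: isomorphic_def)
  moreover have "isomorphic \<tau> ?B ?B"
    by (auto simp: isomorphic_def is_iso_def is_hom_def intro!: exI[of _ id])
  ultimately have "isomorphic \<tau> A ?B"
    using cbs B \<xi> \<sigma>(1) unfolding CBS_property_def by blast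
  then have "isomorphic \<tau> ?B (quot \<tau> e A (Delta A))"
    using isomorphic_sym[OF algebra algebra] isomorphic_quot_Delta isomorphic_trans
      A B quot_in_category[OF A K_closed(1)] by meson
  then have "Delta A \<in> angle \<tau> e \<K> A \<theta> \<sigma>"
    using K_closed(1) bot[OF \<theta>] by (simp add: angle_def)
  moreover have "isGlb (\<K> A) ((\<lambda>n. Nabla A) ` {1::nat..}) (Nabla A)"
    using K_closed(2) top
    by (auto simp: isGlb_def greatestP_def isLb_def setge_def setle_def)
  ultimately show ?thesis using CBS_sequence_Delta by blast
qed

lemma infimum_imp_CBS:
  assumes A: "A \<in> \<A>"
    and inf: "\<And>\<theta> f \<sigma>. \<theta> \<in> \<K> A \<Longrightarrow> is_iso \<tau> A (quot \<tau> e A \<theta>) f \<Longrightarrow> \<sigma> \<in> \<K> A \<Longrightarrow> \<sigma> \<subseteq> \<theta> \<Longrightarrow>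
      \<exists>\<zeta>\<in>angle \<tau> e \<K> A \<theta> \<sigma>. \<exists>s. CBS_sequence \<tau> e \<K> A f \<theta> \<zeta> s \<and>
        (\<exists>\<iota>. isGlb (\<K> A) (s ` {1..}) \<iota>)"
  shows "CBS_property \<tau> e \<A> \<K> A"
  unfolding CBS_property_def
proof (intro ballI impI, elim conjE)
  fix B \<theta>B \<sigma>
  assume B: "B \<in> \<A>" and \<theta>B: "\<theta>B \<in> \<K> B" and \<sigma>: "\<sigma> \<in> \<K> A"
    and AB: "isomorphic \<tau> A (quot \<tau> e B \<theta>B)" and BA: "isomorphic \<tau> B (quot \<tau> e A \<sigma>)"
  obtain h where h: "is_iso \<tau> A (quot \<tau> e B \<theta>B) h" using AB by (auto simp: isomorphic_def)
  obtain g where g: "is_iso \<tau> B (quot \<tau> e A \<sigma>) g" using BA by (auto simp: isomorphic_def)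
  define \<theta> where "\<theta> = transport e A \<sigma> g \<theta>B"
  have \<theta>K: "\<theta> \<in> \<K> A" "\<sigma> \<subseteq> \<theta>"
    unfolding \<theta>_def using transport_in_K[OF A \<sigma> B g \<theta>B] by blast+
  \<comment> \<open>The two given isomorphisms compose to \<open>A \<cong> B/\<theta>\<^sub>B \<cong> A/\<theta>\<close>.\<close>
  have "\<exists>R. correspondence \<tau> A (Delta A) A \<theta> R"
    unfolding \<theta>_def
    using correspondence_comp[OF correspondence_of_iso[OF algebra[OF A] algebra[OF B]
          quotient_hom_id quotient_hom_K[OF B \<theta>B] h] correspondence_transport[OF A \<sigma> B g \<theta>B]]
    by blast
  then have "isomorphic \<tau> A (quot \<tau> e A \<theta>)"
    using isomorphic_of_correspondence[OF quotient_hom_id quotient_hom_K[OF A \<theta>K(1)]] by blast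
  then obtain f where f: "is_iso \<tau> A (quot \<tau> e A \<theta>) f" by (auto simp: isomorphic_def)
  interpret cbs \<tau> e \<A> \<K> A \<theta> f by unfold_locales (fact A \<theta>K(1) f)+
  obtain \<zeta> s \<iota> where \<zeta>: "\<zeta> \<in> angle \<tau> e \<K> A \<theta> \<sigma>" and s: "CBS_sequence \<tau> e \<K> A f \<theta> \<zeta> s"
    and \<iota>: "isGlb (\<K> A) (s ` {1..}) \<iota>"
    using inf[OF \<theta>K(1) f \<sigma> \<theta>K(2)] by blast
  from \<zeta> have \<zeta>K: "\<zeta> \<in> \<K> A" "\<zeta> \<subseteq> \<theta>" and \<sigma>\<zeta>: "isomorphic \<tau> (quot \<tau> e A \<sigma>) (quot \<tau> e A \<zeta>)"
    by (auto simp: angle_def)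
  have "isomorphic \<tau> A (quot \<tau> e A \<zeta>)"
    using \<zeta>K s \<iota> by (rule isomorphic_quot_of_infimum)
  moreover have "isomorphic \<tau> (quot \<tau> e A \<zeta>) B"
    using isomorphic_sym[OF algebra[OF B] algebra[OF quot_in_category[OF A \<zeta>K(1)]]]
      isomorphic_trans[OF BA \<sigma>\<zeta>] by blast
  ultimately show "isomorphic \<tau> A B" by (rule isomorphic_trans)
qed

end

theorem theorem3p14:
  fixes \<tau> :: "'f alg_type"
    and e :: "'u set \<Rightarrow> 'u"
    and \<A> :: "('f, 'u) alg set"
    and \<K> :: "('f, 'u) alg \<Rightarrow> ('u \<times> 'u) set set"
    and A :: "('f, 'u) alg"
  assumes "category_of_algebras \<tau> \<A>"
    and "class_naming \<tau> \<A> e"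
    and "boolean_factor_congruences_presheaf \<tau> e \<A> \<K>"
    and "A \<in> \<A>"
  shows "CBS_property \<tau> e \<A> \<K> A \<longleftrightarrow>
    (\<forall>\<theta>\<in>\<K> A. \<forall>f. is_iso \<tau> A (quot \<tau> e A \<theta>) f \<longrightarrow>
       (\<forall>\<sigma>\<in>\<K> A. \<sigma> \<subseteq> \<theta> \<longrightarrow>
          (\<exists>\<zeta>\<in>angle \<tau> e \<K> A \<theta> \<sigma>. \<exists>s. CBS_sequence \<tau> e \<K> A f \<theta> \<zeta> s \<and>
             (\<exists>\<iota>. isGlb (\<K> A) (s ` {1..}) \<iota>))))"
proof -
  interpret boolean_presheaf \<tau> e \<A> \<K> by unfold_locales (fact assms)+
  show ?thesis
    using CBS_imp_infimum[OF assms(4)] infimum_imp_CBS[OF assms(4)] by (intro iffI) blast+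
qed

end
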